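(* Let $E=(E^0,E^1,r,s)$ be a graph, let $K$ be a field, and let $L_K(E)$ be the associated Leavitt path algebra with its usual $\mathbb{Z}$-grading. If $A$ is a $\mathbb{Z}$-graded ring and $\pi : L_K(E)\to A$ is a graded ring homomorphism with $\pi(v)\neq 0$ for all $v\in E^0$, then $\pi$ is injective.
   Context: Rings and algebras are not assumed commutative or unital, and ideals are two-sided. A graph $E=(E^0,E^1,r,s)$ is a directed graph with a countable vertex set $E^0$, a countable edge set $E^1$, and range and source maps $r,s:E^1\to E^0$ (no row-finiteness is assumed). A vertex $v$ is regular, written $v\in E^0_{\mathrm{reg}}$, if $0<|s^{-1}(v)|<\infty$. A path of length $n\ge 1$ is a sequence $\alpha=e_1\cdots e_n$ of edges with $r(e_i)=s(e_{i+1})$; we set $|\alpha|=n$, $s(\alpha)=s(e_1)$, $r(\alpha)=r(e_n)$. Vertices are paths of length $0$ with $r(v)=s(v)=v$. $E^*$ is the set of all finite paths. For $\alpha=e_1\cdots e_n$, $\alpha^*:=e_n^*\cdots e_1^*$, and $v^*:=v$. The Leavitt path algebra $L_K(E)$ is the universal $K$-algebra generated by a set $\{v:v\in E^0\}$ of pairwise orthogonal idempotents together with elements $\{e,e^*:e\in E^1\}$ satisfying (1) $s(e)e=er(e)=e$ for all $e\in E^1$; (2) $r(e)e^*=e^*s(e)=e^*$ for all $e\in E^1$; (3) $e^*f=\delta_{e,f}\,r(e)$ for all $e,f\in E^1$; (4) $v=\sum_{s(e)=v}ee^*$ for all $v\in E^0_{\mathrm{reg}}$. A ring $R$ is $\mathbb{Z}$-graded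 if there are additive subgroups $R_n$ ($n\in\mathbb{Z}$) with $R=\bigoplus_n R_n$ and $R_mR_n\subseteq R_{m+n}$. A ring homomorphism $\phi:R\to S$ of $\mathbb{Z}$-graded rings is graded if $\phi(R_n)\subseteq S_n$ for all $n$. The usual $\mathbb{Z}$-grading on $L_K(E)$ has $L_K(E)_n$ equal to the $K$-linear span of the elements $\alpha\beta^*$ with $\alpha,\beta\in E^*$ and $|\alpha|-|\beta|=n$. *)

theory Defs
  imports
    "HOL-Algebra.QuotRing"
    "HOL-Algebra.Module"
    "HOL-Library.Poly_Mapping"
    "HOL-Library.Countable_Set"
    "Graph_Theory.Arc_Walk"
begin

section \<open>Rings without unit and \<open>\<int>\<close>-gradings\<close>

text \<open>
  HOL-Algebra's \<^locale>\<open>ring\<close> is unital. Below, its record type is used for rings that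
  need not have a unit; the field \<^const>\<open>one\<close> of such a record plays no role.
\<close>

locale nonunital_ring = abelian_group R for R (structure) +
  assumes m_closed: "\<lbrakk>x \<in> carrier R; y \<in> carrier R\<rbrakk> \<Longrightarrow> x \<otimes> y \<in> carrier R"
    and m_assoc: "\<lbrakk>x \<in> carrier R; y \<in> carrier R; z \<in> carrier R\<rbrakk>
      \<Longrightarrow> (x \<otimes> y) \<otimes> z = x \<otimes> (y \<otimes> z)"
    and l_distr: "\<lbrakk>x \<in> carrier R; y \<in> carrier R; z \<in> carrier R\<rbrakk>
      \<Longrightarrow> (x \<oplus> y) \<otimes> z = x \<otimes> z \<oplus> y \<otimes> z"
    and r_distr: "\<lbrakk>x \<in> carrier R; y \<in> carrier R; z \<in> carrier R\<rbrakk>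
      \<Longrightarrow> z \<otimes> (x \<oplus> y) = z \<otimes> x \<oplus> z \<otimes> y"

locale int_graded_ring = nonunital_ring R for R (structure) +
  fixes D :: "int \<Rightarrow> 'a set"
  assumes component_subgroup: "additive_subgroup (D n) R"
    and direct_sum: "x \<in> carrier R \<Longrightarrow>
      \<exists>!f. (\<forall>n. f n \<in> D n) \<and> finite {n. f n \<noteq> \<zero>} \<and> x = (\<Oplus>n \<in> {n. f n \<noteq> \<zero>}. f n)"
    and component_mult: "\<lbrakk>x \<in> D m; y \<in> D n\<rbrakk> \<Longrightarrow> x \<otimes> y \<in> D (m + n)"

definition nonunital_ring_hom ::
    "('a, 'p) ring_scheme \<Rightarrow> ('b, 'q) ring_scheme \<Rightarrow> ('a \<Rightarrow> 'b) set" where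
  "nonunital_ring_hom R S = {h. h \<in> carrier R \<rightarrow> carrier S \<and>
     (\<forall>x \<in> carrier R. \<forall>y \<in> carrier R. h (x \<oplus>\<^bsub>R\<^esub> y) = h x \<oplus>\<^bsub>S\<^esub> h y) \<and>
     (\<forall>x \<in> carrier R. \<forall>y \<in> carrier R. h (x \<otimes>\<^bsub>R\<^esub> y) = h x \<otimes>\<^bsub>S\<^esub> h y)}"

definition graded_ring_hom ::
    "('a, 'p) ring_scheme \<Rightarrow> (int \<Rightarrow> 'a set) \<Rightarrow> ('b, 'q) ring_scheme \<Rightarrow> (int \<Rightarrow> 'b set)
      \<Rightarrow> ('a \<Rightarrow> 'b) set" where
  "graded_ring_hom R C S D = {h \<in> nonunital_ring_hom R S. \<forall>n. h ` C n \<subseteq> D n}"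


section \<open>Algebras over a field\<close>

text \<open>
  A \<open>K\<close>-algebra is a record of type \<^typ>\<open>('k, 'a) module\<close>, where the field \<open>K\<close> is the
  type \<^typ>\<open>'k\<close>.
\<close>

inductive_set linear_span :: "('k, 'a) module \<Rightarrow> 'a set \<Rightarrow> 'a set"
  for M :: "('k, 'a) module" and S :: "'a set" where
  zero: "\<zero>\<^bsub>M\<^esub> \<in> linear_span M S"
| base: "x \<in> S \<Longrightarrow> x \<in> linear_span M S"
| add: "\<lbrakk>x \<in> linear_span M S; y \<in> linear_span M S\<rbrakk> \<Longrightarrow> x \<oplus>\<^bsub>M\<^esub> y \<in> linear_span M S"
| smult: "x \<in> linear_span M S \<Longrightarrow> c \<odot>\<^bsub>M\<^esub> x \<in> linear_span M S"

text \<open>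
  The two-sided ideal generated by \<open>S\<close>. In the absence of a unit, closure under the scalars
  has to be required separately.
\<close>

inductive_set algebra_ideal :: "('k, 'a) module \<Rightarrow> 'a set \<Rightarrow> 'a set"
  for M :: "('k, 'a) module" and S :: "'a set" where
  zero: "\<zero>\<^bsub>M\<^esub> \<in> algebra_ideal M S"
| base: "x \<in> S \<Longrightarrow> x \<in> algebra_ideal M S"
| add: "\<lbrakk>x \<in> algebra_ideal M S; y \<in> algebra_ideal M S\<rbrakk> \<Longrightarrow> x \<oplus>\<^bsub>M\<^esub> y \<in> algebra_ideal M S"
| smult: "x \<in> algebra_ideal M S \<Longrightarrow> c \<odot>\<^bsub>M\<^esub> x \<in> algebra_ideal M S"
| mult_left: "\<lbrakk>a \<in> carrier M; x \<in> algebra_ideal M S\<rbrakk> \<Longrightarrow> a \<otimes>\<^bsub>M\<^esub> x \<in> algebra_ideal M S"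
| mult_right: "\<lbrakk>a \<in> carrier M; x \<in> algebra_ideal M S\<rbrakk> \<Longrightarrow> x \<otimes>\<^bsub>M\<^esub> a \<in> algebra_ideal M S"

definition quotient_algebra :: "('k, 'a) module \<Rightarrow> 'a set \<Rightarrow> ('k, 'a set) module" where
  "quotient_algebra M I =
     ring.extend (M Quot I) (module.fields (\<lambda>c X. \<Union>x\<in>X. I +>\<^bsub>M\<^esub> (c \<odot>\<^bsub>M\<^esub> x)))"


section \<open>The free algebra without unit\<close>

datatype 'g free_word = Word (letters: "'g list")

instantiation free_word :: (type) monoid_add
begin

definition "0 = Word []"
definition "u + w = Word (letters u @ letters w)"

instance
  by standard (simp_all add: zero_free_word_def plus_free_word_def)

end

text \<open>
  Finitely supported functions on words, with the convolution product of
  \<^typ>\<open>'g free_word \<Rightarrow>\<^sub>0 'k\<close>. Words in the support are non-empty, so there is no unit.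
\<close>

type_synonym ('g, 'k) free_alg = "'g free_word \<Rightarrow>\<^sub>0 'k"

definition word_monom :: "'g list \<Rightarrow> ('g, 'k::field) free_alg" where
  "word_monom w = Poly_Mapping.single (Word w) 1"

definition free_algebra :: "'g set \<Rightarrow> ('k::field, ('g, 'k) free_alg) module" where
  "free_algebra X =
     \<lparr>carrier = {p. \<forall>w \<in> Poly_Mapping.keys p. letters w \<noteq> [] \<and> set (letters w) \<subseteq> X},
      mult = (\<lambda>p q. p * q), one = undefined, zero = 0, add = (\<lambda>p q. p + q),
      smult = (\<lambda>c p. Poly_Mapping.map (\<lambda>a. c * a) p)\<rparr>"


section \<open>Leavitt path algebras\<close>

text \<open>
  A graph is a \<^typ>\<open>('v, 'e) pre_digraph\<close>, the source and range maps being \<^const>\<open>tail\<close> and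
  \<^const>\<open>head\<close>.
\<close>

definition regular_vertex :: "('v, 'e) pre_digraph \<Rightarrow> 'v \<Rightarrow> bool" where
  "regular_vertex E v \<longleftrightarrow> v \<in> verts E \<and> out_arcs E v \<noteq> {} \<and> finite (out_arcs E v)"

datatype ('v, 'e) generator = Vertex 'v | Edge 'e | Ghost 'e

definition leavitt_generators :: "('v, 'e) pre_digraph \<Rightarrow> ('v, 'e) generator set" where
  "leavitt_generators E = Vertex ` verts E \<union> Edge ` arcs E \<union> Ghost ` arcs E"

inductive_set leavitt_relators ::
    "('v, 'e) pre_digraph \<Rightarrow> (('v, 'e) generator, 'k::field) free_alg set"
  for E :: "('v, 'e) pre_digraph" where
  idempotent: "v \<in> verts E \<Longrightarrow>
    word_monom [Vertex v, Vertex v] - word_monom [Vertex v] \<in> leavitt_relators E"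
| orthogonal: "\<lbrakk>v \<in> verts E; w \<in> verts E; v \<noteq> w\<rbrakk> \<Longrightarrow>
    word_monom [Vertex v, Vertex w] \<in> leavitt_relators E"
| source_edge: "e \<in> arcs E \<Longrightarrow>
    word_monom [Vertex (tail E e), Edge e] - word_monom [Edge e] \<in> leavitt_relators E"
| edge_range: "e \<in> arcs E \<Longrightarrow>
    word_monom [Edge e, Vertex (head E e)] - word_monom [Edge e] \<in> leavitt_relators E"
| range_ghost: "e \<in> arcs E \<Longrightarrow>
    word_monom [Vertex (head E e), Ghost e] - word_monom [Ghost e] \<in> leavitt_relators E"
| ghost_source: "e \<in> arcs E \<Longrightarrow>
    word_monom [Ghost e, Vertex (tail E e)] - word_monom [Ghost e] \<in> leavitt_relators E"
| ghost_edge: "e \<in> arcs E \<Longrightarrow>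
    word_monom [Ghost e, Edge e] - word_monom [Vertex (head E e)] \<in> leavitt_relators E"
| ghost_other_edge: "\<lbrakk>e \<in> arcs E; f \<in> arcs E; e \<noteq> f\<rbrakk> \<Longrightarrow>
    word_monom [Ghost e, Edge f] \<in> leavitt_relators E"
| cuntz_krieger: "regular_vertex E v \<Longrightarrow>
    word_monom [Vertex v] - (\<Sum>e \<in> out_arcs E v. word_monom [Edge e, Ghost e])
      \<in> leavitt_relators E"

text \<open>
  The universal algebra on these generators and relations, as a quotient of the free algebra.
  The coefficient field \<^typ>\<open>'k\<close> is not determined by \<open>E\<close> and is fixed by the type.
\<close>

definition leavitt_ideal ::
    "('v, 'e) pre_digraph \<Rightarrow> (('v, 'e) generator, 'k::field) free_alg set" where
  "leavitt_ideal E = algebra_ideal (free_algebra (leavitt_generators E)) (leavitt_relators E)"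

type_synonym ('v, 'e, 'k) leavitt = "(('v, 'e) generator, 'k) free_alg set"

definition leavitt_algebra ::
    "('v, 'e) pre_digraph \<Rightarrow> ('k::field, ('v, 'e, 'k) leavitt) module" where
  "leavitt_algebra E =
     quotient_algebra (free_algebra (leavitt_generators E)) (leavitt_ideal E)"

definition leavitt_monom ::
    "('v, 'e) pre_digraph \<Rightarrow> ('v, 'e) generator list \<Rightarrow> ('v, 'e, 'k::field) leavitt" where
  "leavitt_monom E w =
     leavitt_ideal E +>\<^bsub>free_algebra (leavitt_generators E)\<^esub> word_monom w"

definition leavitt_vertex ::
    "('v, 'e) pre_digraph \<Rightarrow> 'v \<Rightarrow> ('v, 'e, 'k::field) leavitt" where
  "leavitt_vertex E v = leavitt_monom E [Vertex v]"

text \<open>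
  A path in \<open>E\<^sup>*\<close> is given by its source \<open>u\<close> and its list of edges \<open>p\<close>; the list is empty
  for the path of length zero at \<open>u\<close>.
\<close>

definition leavitt_path ::
    "('v, 'e) pre_digraph \<Rightarrow> 'v \<Rightarrow> 'e list \<Rightarrow> ('v, 'e, 'k::field) leavitt" where
  "leavitt_path E u p = leavitt_monom E (if p = [] then [Vertex u] else map Edge p)"

definition leavitt_ghost_path ::
    "('v, 'e) pre_digraph \<Rightarrow> 'v \<Rightarrow> 'e list \<Rightarrow> ('v, 'e, 'k::field) leavitt" where
  "leavitt_ghost_path E u p = leavitt_monom E (if p = [] then [Vertex u] else map Ghost (rev p))"

definition leavitt_grading ::
    "('v, 'e) pre_digraph \<Rightarrow> int \<Rightarrow> ('v, 'e, 'k::field) leavitt set" where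
  "leavitt_grading E n = linear_span (leavitt_algebra E)
     {leavitt_path E u p \<otimes>\<^bsub>leavitt_algebra E\<^esub> leavitt_ghost_path E u' q | u p v u' q v'.
        pre_digraph.awalk E u p v \<and> pre_digraph.awalk E u' q v' \<and>
        int (length p) - int (length q) = n}"

end

theory Submission
  imports Defs
begin

text \<open>
  Let \<open>J\<close> be the kernel of a graded homomorphism that does not vanish at any vertex. The components
  of an element of \<open>J\<close> lie in \<open>J\<close> themselves, since the target is graded. So it is enough to show
  that an ideal which contains no vertex contains no homogeneous element except zero.

  A homogeneous element \<open>x\<close> of degree \<open>n\<close> is a combination of monomials \<open>\<alpha> \<beta>\<^sup>*\<close> with
  \<open>|\<alpha>| - |\<beta>| = n\<close>. If all \<open>\<beta>\<close> are trivial, then \<open>x v\<close> is, for each vertex \<open>v\<close>, a combination of paths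
  of length \<open>n\<close> ending at \<open>v\<close>. Distinct paths of equal length satisfy \<open>\<alpha>\<^sup>* \<alpha>' = 0\<close>, so if \<open>x v\<close> is not
  zero, a suitable \<open>\<alpha>\<^sup>* x v\<close> is a non-zero multiple of \<open>v\<close>, and \<open>v\<close> lies in \<open>J\<close>
  (\<open>nonzero_path_combination_generates_vertex\<close>). In general one proceeds by induction on the
  length of the \<open>\<beta>\<close>: multiplication by an edge shortens them, so \<open>x e = 0\<close> for all edges \<open>e\<close>. At
  regular vertices, \<open>x v = 0\<close> follows by the Cuntz--Krieger relation. At a sink or infinite emitter
  the finitely many edges that begin a \<open>\<beta>\<close> in \<open>x v\<close> are not all edges at \<open>v\<close>, unless there are none,
  and this allows the part of \<open>x v\<close> with trivial \<open>\<beta>\<close> to be isolated and seen to vanish; for the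
  rest, the finitely many projections \<open>e e\<^sup>*\<close> again act as a unit (\<open>no_homogeneous_kernel\<close>). Finally \<open>x\<close>
  is zero, because finite sums of vertices are local units.

  The vertices are non-zero because their images are, so the relations suffice for the argument,
  which takes place in an arbitrary algebra with a family of elements that satisfies them
  (\<open>leavitt_family\<close>). The Leavitt path algebra is such an algebra (\<open>leavitt_algebra_family\<close>), and
  it is spanned by the monomials \<open>\<alpha> \<beta>\<^sup>*\<close> (\<open>leavitt_algebra_spanned\<close>).
\<close>

section \<open>Algebras over a field\<close>

declare (in nonunital_ring) m_closed [simp, intro]

context nonunital_ring
begin

lemma l_null [simp]: "x \<in> carrier R \<Longrightarrow> \<zero> \<otimes> x = \<zero>"
  using l_distr[of \<zero> \<zero> x] add.l_cancel_one by fastforce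

lemma r_null [simp]: "x \<in> carrier R \<Longrightarrow> x \<otimes> \<zero> = \<zero>"
  using r_distr[of \<zero> \<zero> x] add.l_cancel_one by fastforce

end

locale field_algebra = nonunital_ring M for M :: "('k::field, 'a) module" (structure) +
  assumes smult_closed [simp, intro]: "x \<in> carrier M \<Longrightarrow> c \<odot> x \<in> carrier M"
    and smult_r_distr: "\<lbrakk>x \<in> carrier M; y \<in> carrier M\<rbrakk> \<Longrightarrow> c \<odot> (x \<oplus> y) = c \<odot> x \<oplus> c \<odot> y"
    and smult_l_distr: "x \<in> carrier M \<Longrightarrow> (c + d) \<odot> x = c \<odot> x \<oplus> d \<odot> x"
    and smult_assoc: "x \<in> carrier M \<Longrightarrow> (c * d) \<odot> x = c \<odot> (d \<odot> x)"
    and smult_one: "x \<in> carrier M \<Longrightarrow> 1 \<odot> x = x"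
    and mult_smult_left: "\<lbrakk>x \<in> carrier M; y \<in> carrier M\<rbrakk> \<Longrightarrow> (c \<odot> x) \<otimes> y = c \<odot> (x \<otimes> y)"
    and mult_smult_right: "\<lbrakk>x \<in> carrier M; y \<in> carrier M\<rbrakk> \<Longrightarrow> x \<otimes> (c \<odot> y) = c \<odot> (x \<otimes> y)"
begin

lemma smult_zero_left [simp]: "x \<in> carrier M \<Longrightarrow> 0 \<odot> x = \<zero>"
  using smult_l_distr[of x 0 0] add.l_cancel_one by fastforce

definition linear_map :: "('a \<Rightarrow> 'a) \<Rightarrow> bool" where
  "linear_map f \<longleftrightarrow> f \<in> carrier M \<rightarrow> carrier M \<and>
     (\<forall>x\<in>carrier M. \<forall>y\<in>carrier M. f (x \<oplus> y) = f x \<oplus> f y) \<and>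
     (\<forall>c. \<forall>x\<in>carrier M. f (c \<odot> x) = c \<odot> f x)"

lemma linear_mapI:
  assumes "\<And>x. x \<in> carrier M \<Longrightarrow> f x \<in> carrier M"
    and "\<And>x y. \<lbrakk>x \<in> carrier M; y \<in> carrier M\<rbrakk> \<Longrightarrow> f (x \<oplus> y) = f x \<oplus> f y"
    and "\<And>c x. x \<in> carrier M \<Longrightarrow> f (c \<odot> x) = c \<odot> f x"
  shows "linear_map f"
  using assms by (auto simp: linear_map_def)

lemma
  assumes "linear_map f"
  shows linear_map_closed: "x \<in> carrier M \<Longrightarrow> f x \<in> carrier M"
    and linear_map_add: "\<lbrakk>x \<in> carrier M; y \<in> carrier M\<rbrakk> \<Longrightarrow> f (x \<oplus> y) = f x \<oplus> f y"
    and linear_map_smult: "x \<in> carrier M \<Longrightarrow> f (c \<odot> x) = c \<odot> f x"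
  using assms by (auto simp: linear_map_def)

lemma linear_map_zero:
  assumes "linear_map f" shows "f \<zero> = \<zero>"
proof -
  have "f \<zero> \<oplus> f \<zero> = f \<zero>"
    using linear_map_add[OF assms, of \<zero> \<zero>] by simp
  then show ?thesis
    using linear_map_closed[OF assms, of \<zero>] add.l_cancel_one by fastforce
qed

lemma linear_map_lmult: "a \<in> carrier M \<Longrightarrow> linear_map (\<lambda>x. a \<otimes> x)"
  by (rule linear_mapI) (auto simp: r_distr mult_smult_right)

lemma linear_map_rmult: "a \<in> carrier M \<Longrightarrow> linear_map (\<lambda>x. x \<otimes> a)"
  by (rule linear_mapI) (auto simp: l_distr mult_smult_left)

lemma linear_map_smult_const: "linear_map (\<lambda>x. c \<odot> x)"
  by (rule linear_mapI) (auto simp: smult_r_distr smult_assoc[symmetric] mult.commute)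

lemma linear_map_comp: "\<lbrakk>linear_map f; linear_map g\<rbrakk> \<Longrightarrow> linear_map (\<lambda>x. f (g x))"
  by (rule linear_mapI) (auto simp: linear_map_closed linear_map_add linear_map_smult)

lemma linear_map_finsum:
  assumes f: "linear_map f" and "finite F" and "g \<in> F \<rightarrow> carrier M"
  shows "f (\<Oplus>i\<in>F. g i) = (\<Oplus>i\<in>F. f (g i))"
  using assms(2,3)
proof (induction F rule: finite_induct)
  case empty
  then show ?case using linear_map_zero[OF f] by simp
next
  case (insert i F)
  then have "g i \<in> carrier M" "g \<in> F \<rightarrow> carrier M" by auto
  moreover from this have "(\<lambda>i. f (g i)) \<in> F \<rightarrow> carrier M" "f (g i) \<in> carrier M"
    using linear_map_closed[OF f] by auto
  ultimately show ?case
    using insert.hyps insert.IH linear_map_add[OF f] by simp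
qed

lemma finsum_extend:
  assumes "finite F'" "F \<subseteq> F'" "g \<in> F \<rightarrow> carrier M" "\<And>i. i \<in> F' - F \<Longrightarrow> g i = \<zero>"
  shows "(\<Oplus>i\<in>F. g i) = (\<Oplus>i\<in>F'. g i)"
proof (rule add.finprod_mono_neutral_cong_left)
  show "g \<in> F' \<rightarrow> carrier M" using assms by (metis DiffI Pi_I Pi_mem zero_closed)
qed (use assms in auto)

lemma linear_span_closed:
  assumes "S \<subseteq> carrier M" and "x \<in> linear_span M S"
  shows "x \<in> carrier M"
  using assms(2) by induction (use assms(1) in auto)

lemma linear_span_mono:
  assumes "S \<subseteq> T" and "x \<in> linear_span M S"
  shows "x \<in> linear_span M T"
  using assms(2) by induction (use assms(1) in \<open>auto intro: linear_span.intros\<close>)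

lemma linear_span_image:
  assumes f: "linear_map f" and S: "S \<subseteq> carrier M"
    and img: "\<And>s. s \<in> S \<Longrightarrow> f s \<in> linear_span M T"
    and x: "x \<in> linear_span M S"
  shows "f x \<in> linear_span M T"
  using x
proof induction
  case zero
  then show ?case using linear_map_zero[OF f] by (simp add: linear_span.zero)
next
  case (add x y)
  then show ?case
    using linear_span_closed[OF S] by (simp add: linear_map_add[OF f] linear_span.add)
next
  case (smult x c)
  then show ?case
    using linear_span_closed[OF S] by (simp add: linear_map_smult[OF f] linear_span.smult)
qed (rule img)

lemma linear_span_singleton:
  assumes "a \<in> carrier M" and "x \<in> linear_span M {a}"
  shows "\<exists>c. x = c \<odot> a"
  using assms(2)
proof induction
  case zero
  then show ?case using assms(1) by (metis smult_zero_left)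
next
  case (base x)
  then show ?case using assms(1) by (metis smult_one singletonD)
next
  case (add x y)
  then show ?case using assms(1) by (metis smult_l_distr)
next
  case (smult x c)
  then show ?case using assms(1) by (metis smult_assoc)
qed

text \<open>
  The family \<open>t\<close> behaves like a system of orthogonal projections, of which each spanning vector
  lies in the image of exactly one (or is zero). A linear combination involves only finitely many
  of them, and they add up to the identity on it. This yields local units, both for the vertices and for the
  projections \<open>e e\<^sup>*\<close> of the edges that leave a vertex, however many these are.
\<close>

lemma linear_span_orthogonal_support:
  assumes t: "\<And>i. i \<in> I \<Longrightarrow> linear_map (t i)" and S: "S \<subseteq> carrier M"
    and loc: "\<And>s. s \<in> S \<Longrightarrow> \<exists>i\<in>I. t i s = s \<and> (\<forall>j\<in>I - {i}. t j s = \<zero>)"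
    and x: "x \<in> linear_span M S"
  shows "\<exists>F. finite F \<and> F \<subseteq> I \<and> (\<forall>j\<in>I - F. t j x = \<zero>) \<and> x = (\<Oplus>i\<in>F. t i x)"
  using x
proof induction
  case zero
  then show ?case using linear_map_zero[OF t] by (intro exI[of _ "{}"]) auto
next
  case (base s)
  then obtain i where i: "i \<in> I" "t i s = s" "\<forall>j\<in>I - {i}. t j s = \<zero>"
    using loc by blast
  moreover have "(\<Oplus>i\<in>{i}. t i s) = s"
    using i base S by (subst finsum_insert) auto
  ultimately show ?case by (intro exI[of _ "{i}"]) auto
next
  case (add x y)
  then obtain F G where F: "finite F" "F \<subseteq> I" "\<forall>j\<in>I - F. t j x = \<zero>" "x = (\<Oplus>i\<in>F. t i x)"
    and G: "finite G" "G \<subseteq> I" "\<forall>j\<in>I - G. t j y = \<zero>" "y = (\<Oplus>i\<in>G. t i y)" by blast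
  have xy: "x \<in> carrier M" "y \<in> carrier M"
    using add.hyps linear_span_closed[OF S] by auto
  have tx: "t i x \<in> carrier M" and ty: "t i y \<in> carrier M" if "i \<in> I" for i
    using xy that t linear_map_closed by auto
  let ?H = "F \<union> G"
  have H: "finite ?H" "?H \<subseteq> I" using F G by auto
  have "x = (\<Oplus>i\<in>?H. t i x)"
    by (rule trans[OF F(4)], rule finsum_extend) (use F H tx in auto)
  moreover have "y = (\<Oplus>i\<in>?H. t i y)"
    by (rule trans[OF G(4)], rule finsum_extend) (use G H ty in auto)
  ultimately have "x \<oplus> y = (\<Oplus>i\<in>?H. t i x) \<oplus> (\<Oplus>i\<in>?H. t i y)" by argo
  also have "\<dots> = (\<Oplus>i\<in>?H. t i x \<oplus> t i y)"
    by (rule add.finprod_multf[symmetric]) (use tx ty H in auto)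
  also have "\<dots> = (\<Oplus>i\<in>?H. t i (x \<oplus> y))"
    by (rule finsum_cong') (use tx ty H xy in \<open>auto simp: linear_map_add[OF t]\<close>)
  finally have "x \<oplus> y = (\<Oplus>i\<in>?H. t i (x \<oplus> y))" .
  moreover have "\<forall>j\<in>I - ?H. t j (x \<oplus> y) = \<zero>"
    using F(3) G(3) xy by (simp add: linear_map_add[OF t])
  ultimately show ?case using H by blast
next
  case (smult x c)
  then obtain F where F: "finite F" "F \<subseteq> I" "\<forall>j\<in>I - F. t j x = \<zero>" "x = (\<Oplus>i\<in>F. t i x)"
    by blast
  have x: "x \<in> carrier M"
    using smult.hyps linear_span_closed[OF S] by auto
  have tx: "t i x \<in> carrier M" if "i \<in> I" for i
    using x that t linear_map_closed by auto
  have "c \<odot> x = c \<odot> (\<Oplus>i\<in>F. t i x)" using F(4) by simp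
  also have "\<dots> = (\<Oplus>i\<in>F. c \<odot> t i x)"
    by (rule linear_map_finsum[OF linear_map_smult_const]) (use F tx in auto)
  also have "\<dots> = (\<Oplus>i\<in>F. t i (c \<odot> x))"
    by (rule finsum_cong') (use tx F x in \<open>auto simp: linear_map_smult[OF t]\<close>)
  finally have "c \<odot> x = (\<Oplus>i\<in>F. t i (c \<odot> x))" .
  moreover have "\<forall>j\<in>I - F. t j (c \<odot> x) = \<zero>"
    using F(3) x linear_map_zero[OF linear_map_smult_const]
    by (simp add: linear_map_smult[OF t])
  ultimately show ?case using F by blast
qed

corollary linear_span_orthogonal_zero:
  assumes t: "\<And>i. i \<in> I \<Longrightarrow> linear_map (t i)" and S: "S \<subseteq> carrier M"
    and loc: "\<And>s. s \<in> S \<Longrightarrow> \<exists>i\<in>I. t i s = s \<and> (\<forall>j\<in>I - {i}. t j s = \<zero>)"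
    and x: "x \<in> linear_span M S" and zero: "\<And>i. i \<in> I \<Longrightarrow> t i x = \<zero>"
  shows "x = \<zero>"
proof -
  obtain F where F: "F \<subseteq> I" "x = (\<Oplus>i\<in>F. t i x)"
    using linear_span_orthogonal_support[OF t S loc x] by blast
  have "(\<Oplus>i\<in>F. t i x) = \<zero>"
    using F(1) zero by (intro add.finprod_one_eqI) auto
  with F(2) show ?thesis by simp
qed

end

section \<open>Leavitt families\<close>

text \<open>
  Vertices, edges and ghost edges are represented by elements \<open>V\<close>, \<open>X\<close> and \<open>Y\<close> of an arbitrary
  algebra that satisfy the defining relations of a Leavitt path algebra. Everything up to the
  passage to the target ring follows from these relations alone, so that the cosets that make up
  the universal algebra stay out of sight.
\<close>

locale leavitt_family = field_algebra M + wf_digraph E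
  for M :: "('k::field, 'a) module" (structure) and E :: "('v, 'e) pre_digraph" +
  fixes V :: "'v \<Rightarrow> 'a" and X :: "'e \<Rightarrow> 'a" and Y :: "'e \<Rightarrow> 'a"
  assumes V_closed [simp]: "v \<in> verts E \<Longrightarrow> V v \<in> carrier M"
    and X_closed [simp]: "e \<in> arcs E \<Longrightarrow> X e \<in> carrier M"
    and Y_closed [simp]: "e \<in> arcs E \<Longrightarrow> Y e \<in> carrier M"
    and V_V: "\<lbrakk>v \<in> verts E; w \<in> verts E\<rbrakk> \<Longrightarrow> V v \<otimes> V w = (if v = w then V v else \<zero>)"
    and V_X: "e \<in> arcs E \<Longrightarrow> V (tail E e) \<otimes> X e = X e"
    and X_V: "e \<in> arcs E \<Longrightarrow> X e \<otimes> V (head E e) = X e"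
    and V_Y: "e \<in> arcs E \<Longrightarrow> V (head E e) \<otimes> Y e = Y e"
    and Y_V: "e \<in> arcs E \<Longrightarrow> Y e \<otimes> V (tail E e) = Y e"
    and Y_X: "\<lbrakk>e \<in> arcs E; f \<in> arcs E\<rbrakk> \<Longrightarrow> Y e \<otimes> X f = (if e = f then V (head E e) else \<zero>)"
    and cuntz_krieger: "regular_vertex E v \<Longrightarrow> V v = (\<Oplus>e\<in>out_arcs E v. X e \<otimes> Y e)"
begin

lemma V_X': assumes "e \<in> arcs E" "v \<in> verts E"
  shows "V v \<otimes> X e = (if v = tail E e then X e else \<zero>)"
proof -
  have "V v \<otimes> X e = (V v \<otimes> V (tail E e)) \<otimes> X e"
    using assms by (simp add: m_assoc V_X)
  then show ?thesis using assms by (simp add: V_V V_X)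
qed

primrec path :: "'v \<Rightarrow> 'e list \<Rightarrow> 'a" where
  "path u [] = V u"
| "path u (e # p) = X e \<otimes> path (head E e) p"

text \<open>
  With \<open>p\<close> as the path, this is \<open>p\<^sup>*\<close>, so the ghost edges come in reverse order.
\<close>

primrec ghost :: "'v \<Rightarrow> 'e list \<Rightarrow> 'a" where
  "ghost u [] = V u"
| "ghost u (e # p) = ghost (head E e) p \<otimes> Y e"

lemma path_closed [simp, intro]: "awalk u p v \<Longrightarrow> path u p \<in> carrier M"
  by (induction p arbitrary: u) (auto simp: awalk_simps)

lemma ghost_closed [simp, intro]: "awalk u p v \<Longrightarrow> ghost u p \<in> carrier M"
  by (induction p arbitrary: u) (auto simp: awalk_simps)

lemma path_V:
  assumes "awalk u p v" "w \<in> verts E"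
  shows "path u p \<otimes> V w = (if w = v then path u p else \<zero>)"
  using assms(1)
proof (induction p arbitrary: u)
  case Nil
  then show ?case using assms(2) by (auto simp: awalk_simps V_V)
next
  case (Cons e p)
  then have p: "e \<in> arcs E" "awalk (head E e) p v" by (auto simp: awalk_simps)
  then have "path u (e # p) \<otimes> V w = X e \<otimes> (path (head E e) p \<otimes> V w)"
    using assms(2) by (simp add: m_assoc[OF _ path_closed[OF p(2)]])
  then show ?case using Cons.IH[OF p(2)] p by simp
qed

lemma V_path: assumes "awalk u p v"
  shows "V u \<otimes> path u p = path u p"
proof (cases p)
  case Nil
  then show ?thesis using assms by (auto simp: awalk_simps V_V)
next
  case (Cons e q)
  then have "e \<in> arcs E" "awalk (head E e) q v" "u = tail E e" "u \<in> verts E"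
    using assms by (auto simp: awalk_simps)
  with Cons show ?thesis
    by (simp add: m_assoc[symmetric] path_closed V_X)
qed

lemma ghost_V:
  assumes "awalk u q v" "w \<in> verts E"
  shows "ghost u q \<otimes> V w = (if w = u then ghost u q else \<zero>)"
proof (cases q)
  case Nil
  then show ?thesis using assms by (auto simp: awalk_simps V_V)
next
  case (Cons e p)
  then have p: "e \<in> arcs E" "awalk (head E e) p v" "u = tail E e" "u \<in> verts E"
    using assms by (auto simp: awalk_simps)
  have "Y e \<otimes> V w = (Y e \<otimes> V u) \<otimes> V w"
    using p by (simp add: Y_V)
  also have "\<dots> = Y e \<otimes> (V u \<otimes> V w)" using p assms(2) by (intro m_assoc) auto
  finally have "Y e \<otimes> V w = (if w = u then Y e else \<zero>)"
    using p assms(2) by (auto simp: V_V Y_V)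
  with p Cons assms(2) show ?thesis
    by (simp add: m_assoc[OF ghost_closed[OF p(2)]] ghost_closed[OF p(2)])
qed

lemma path_snoc:
  assumes "awalk u p v" "e \<in> arcs E" "tail E e = v"
  shows "path u p \<otimes> X e = path u (p @ [e])"
  using assms(1)
proof (induction p arbitrary: u)
  case Nil
  then show ?case using assms(2,3) by (auto simp: awalk_simps V_X X_V)
next
  case (Cons f p)
  then have p: "f \<in> arcs E" "awalk (head E f) p v" by (auto simp: awalk_simps)
  then show ?case using assms(2) Cons.IH[OF p(2)]
    by (simp add: m_assoc[OF _ path_closed[OF p(2)]])
qed

lemma path_X_other:
  assumes "awalk u p v" "e \<in> arcs E" "tail E e \<noteq> v"
  shows "path u p \<otimes> X e = \<zero>"
proof -
  have "path u p \<otimes> X e = (path u p \<otimes> V (tail E e)) \<otimes> X e"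
    using assms(1,2) by (simp add: m_assoc[OF path_closed[OF assms(1)]] V_X)
  then show ?thesis using assms path_V[OF assms(1), of "tail E e"] by simp
qed

lemma ghost_Cons_X:
  assumes "awalk u (f # q) v" "e \<in> arcs E"
  shows "ghost u (f # q) \<otimes> X e = (if f = e then ghost (head E e) q else \<zero>)"
proof -
  have p: "f \<in> arcs E" "awalk (head E f) q v"
    using assms by (auto simp: awalk_simps)
  then have "ghost u (f # q) \<otimes> X e = ghost (head E f) q \<otimes> (Y f \<otimes> X e)"
    using assms by (simp add: m_assoc[OF ghost_closed[OF p(2)]])
  with p assms(2) show ?thesis
    using ghost_V[OF p(2), of "head E f"] ghost_closed[OF p(2)] by (auto simp: Y_X)
qed

lemma ghost_Y_other:
  assumes "awalk u q v" "e \<in> arcs E" "head E e \<noteq> u"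
  shows "ghost u q \<otimes> Y e = \<zero>"
proof -
  have "ghost u q \<otimes> Y e = (ghost u q \<otimes> V (head E e)) \<otimes> Y e"
    using assms(1,2) by (simp add: m_assoc[OF ghost_closed[OF assms(1)]] V_Y)
  then show ?thesis using assms ghost_V[OF assms(1), of "head E e"] by simp
qed

text \<open>
  Paths of equal length cancel edge by edge. For different lengths a proper piece
  of a path or ghost path may survive, which is why homogeneity matters later.
\<close>

lemma ghost_path:
  assumes "awalk u p v" "awalk u' p' v" "length p = length p'"
  shows "ghost u p \<otimes> path u' p' = (if (u, p) = (u', p') then V v else \<zero>)"
  using assms
proof (induction p arbitrary: u u' p')
  case Nil
  then show ?case by (auto simp: awalk_simps V_V)
next
  case (Cons e p)
  then obtain f r where p': "p' = f # r" by (cases p') auto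
  with Cons.prems have w: "e \<in> arcs E" "awalk (head E e) p v" "u = tail E e"
    "f \<in> arcs E" "awalk (head E f) r v" "u' = tail E f" "length p = length r"
    by (auto simp: awalk_simps)
  note cl = ghost_closed[OF w(2)] path_closed[OF w(5)]
  have "ghost u (e # p) \<otimes> path u' p' = ghost (head E e) p \<otimes> (Y e \<otimes> (X f \<otimes> path (head E f) r))"
    using w cl p' by (simp add: m_assoc)
  also have "\<dots> = ghost (head E e) p \<otimes> ((Y e \<otimes> X f) \<otimes> path (head E f) r)"
    using w cl by (simp add: m_assoc)
  also have "\<dots> = (if e = f then ghost (head E e) p \<otimes> path (head E f) r else \<zero>)"
    using w cl V_path[OF w(5)] by (simp add: Y_X)
  also have "\<dots> = (if (u, e # p) = (u', p') then V v else \<zero>)"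
    using Cons.IH[OF w(2,5,7)] w p' by auto
  finally show ?case .
qed

definition paths_into :: "int \<Rightarrow> 'v \<Rightarrow> ('v \<times> 'e list) set" where
  "paths_into n v = {(u, p). awalk u p v \<and> int (length p) = n}"

lemma paths_into_closed: "(\<lambda>(u, p). path u p) ` paths_into n v \<subseteq> carrier M"
  by (auto simp: paths_into_def)

text \<open>
  The elements \<open>\<alpha> \<alpha>\<^sup>*\<close>, for \<open>\<alpha>\<close> of the given length and with range \<open>v\<close>, are orthogonal projections
  onto the lines through the \<open>\<alpha>\<close>. As \<open>y\<close> is not zero, some \<open>\<alpha>\<^sup>* y\<close> is not zero; it is a multiple
  of \<open>v\<close>, and the scalar can be inverted.
\<close>

lemma nonzero_path_combination_generates_vertex:
  assumes y: "y \<in> linear_span M ((\<lambda>(u, p). path u p) ` paths_into n v)"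
    and v: "v \<in> verts E" and nz: "y \<noteq> \<zero>"
  shows "\<exists>a\<in>carrier M. a \<otimes> y = V v"
proof -
  let ?S = "(\<lambda>(u, p). path u p) ` paths_into n v"
  let ?t = "\<lambda>(u, p) x. path u p \<otimes> (ghost u p \<otimes> x)"
  have S: "?S \<subseteq> carrier M" by (auto simp: paths_into_def)
  have yc: "y \<in> carrier M" using linear_span_closed[OF S y] .
  have lin: "linear_map (?t i)" if "i \<in> paths_into n v" for i
    using that by (auto simp: paths_into_def intro!: linear_map_comp[OF linear_map_lmult linear_map_lmult])
  have gp: "ghost u p \<otimes> path u' p' = (if (u, p) = (u', p') then V v else \<zero>)"
    if "(u, p) \<in> paths_into n v" "(u', p') \<in> paths_into n v" for u p u' p'
    using that by (intro ghost_path) (auto simp: paths_into_def)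
  have loc: "\<exists>i\<in>paths_into n v. ?t i s = s \<and> (\<forall>j\<in>paths_into n v - {i}. ?t j s = \<zero>)"
    if "s \<in> ?S" for s
  proof -
    from that obtain u p where s: "s = path u p" and i: "(u, p) \<in> paths_into n v" by auto
    then have "awalk u p v" by (simp add: paths_into_def)
    then have "?t (u, p) s = s" using gp[OF i i] path_V[of u p v v] v s by simp
    moreover have "?t j s = \<zero>" if j: "j \<in> paths_into n v - {(u, p)}" for j
    proof -
      obtain u' p' where jj: "j = (u', p')" by force
      then have "awalk u' p' v" "ghost u' p' \<otimes> s = \<zero>"
        using gp[of u' p' u p] j i s by (auto simp: paths_into_def)
      then show ?thesis using jj by (simp add: path_closed)
    qed
    ultimately show ?thesis using i by blast
  qed
  obtain u p where i: "(u, p) \<in> paths_into n v" and t: "?t (u, p) y \<noteq> \<zero>"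
    using linear_span_orthogonal_zero[of "paths_into n v" ?t, OF lin S loc y] nz by fast
  have w: "awalk u p v" using i by (simp add: paths_into_def)
  have g: "ghost u p \<in> carrier M" using w by blast
  have "ghost u p \<otimes> y \<in> linear_span M {V v}"
  proof (rule linear_span_image[OF linear_map_lmult[OF g] S _ y])
    fix s assume "s \<in> ?S"
    then show "ghost u p \<otimes> s \<in> linear_span M {V v}"
      using gp[OF i] by (auto simp: linear_span.zero linear_span.base)
  qed
  then obtain c where c: "ghost u p \<otimes> y = c \<odot> V v"
    using linear_span_singleton[of "V v"] v by auto
  have "c \<noteq> 0"
  proof
    assume "c = 0"
    with c v have "ghost u p \<otimes> y = \<zero>" by simp
    with t w show False by (simp add: path_closed)
  qed
  then have "(inverse c \<odot> ghost u p) \<otimes> y = V v"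
    using c v g yc by (simp add: mult_smult_left smult_assoc[symmetric] smult_one)
  then show ?thesis using g by blast
qed

section \<open>Monomials and their products with generators\<close>

text \<open>
  The bound \<open>m\<close> on the length of \<open>\<beta>\<close> in \<open>\<alpha> \<beta>\<^sup>*\<close> is the parameter of the induction by which the
  homogeneous part of an ideal is treated. The ranges of \<open>\<alpha>\<close> and \<open>\<beta>\<close> may differ, in which case
  the product is zero.
\<close>

definition monomials :: "int \<Rightarrow> nat \<Rightarrow> 'a set" where
  "monomials n m = {path u p \<otimes> ghost u' q | u p v u' q v'. awalk u p v \<and> awalk u' q v' \<and>
     int (length p) - int (length q) = n \<and> length q \<le> m}"

lemma monomials_closed: "monomials n m \<subseteq> carrier M"
  by (auto simp: monomials_def)

lemma monomials_mono: "m \<le> m' \<Longrightarrow> monomials n m \<subseteq> monomials n m'"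
  unfolding monomials_def by (rule Collect_mono) (use le_trans in blast)

lemma monomialsI:
  assumes "awalk u p v" "awalk u' q v'" "int (length p) - int (length q) = n" "length q \<le> m"
  shows "path u p \<otimes> ghost u' q \<in> monomials n m"
  using assms unfolding monomials_def by blast

lemma path_in_monomials:
  assumes "awalk u p v"
  shows "path u p \<in> monomials (int (length p)) m"
proof -
  have v: "v \<in> verts E" using assms by auto
  then have "path u p = path u p \<otimes> ghost v []"
    using path_V[OF assms] by simp
  also have "\<dots> \<in> monomials (int (length p)) m"
    by (rule monomialsI) (use assms v in \<open>auto simp: awalk_simps\<close>)
  finally show ?thesis .
qed

text \<open>
  Multiplication by an edge shortens the ghost part; if there is none, it lengthens the path. In
  the second case the bound stays at \<open>0\<close>, which is what truncated subtraction says.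
\<close>

lemma monomials_X:
  assumes s: "s \<in> monomials n m" and e: "e \<in> arcs E"
  shows "s \<otimes> X e \<in> insert \<zero> (monomials (n + 1) (m - 1))"
proof -
  from s obtain u p v u' q v' where s': "s = path u p \<otimes> ghost u' q"
    and w: "awalk u p v" "awalk u' q v'" and n: "int (length p) - int (length q) = n"
    and m: "length q \<le> m"
    unfolding monomials_def by blast
  note cl = path_closed[OF w(1)] ghost_closed[OF w(2)]
  show ?thesis
  proof (cases q)
    case Nil
    then have u': "u' \<in> verts E" using w by (auto simp: awalk_simps)
    have "s \<otimes> X e = (if u' = tail E e then path u p \<otimes> X e else \<zero>)"
      using s' cl e Nil u' by (simp add: m_assoc V_X')
    moreover have "path u p \<otimes> X e \<in> insert \<zero> (monomials (n + 1) (m - 1))"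
    proof (cases "tail E e = v")
      case True
      have "awalk u (p @ [e]) (head E e)"
        using w(1) e True by (auto simp: awalk_simps intro: awalk_appendI)
      from path_in_monomials[OF this, of "m - 1"] show ?thesis
        using path_snoc[OF w(1) e True] n Nil by (simp add: algebra_simps)
    qed (simp add: path_X_other[OF w(1) e])
    ultimately show ?thesis by simp
  next
    case (Cons f r)
    with w have r: "awalk (head E f) r v'" by (auto simp: awalk_simps)
    have "s \<otimes> X e = path u p \<otimes> (ghost u' (f # r) \<otimes> X e)"
      using s' cl e Cons by (simp add: m_assoc)
    also have "\<dots> = (if f = e then path u p \<otimes> ghost (head E f) r else \<zero>)"
      using ghost_Cons_X[of u' f r v' e] w Cons e cl by auto
    finally show ?thesis
      using monomialsI[OF w(1) r] n m Cons by auto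
  qed
qed

lemma monomials_V:
  assumes s: "s \<in> monomials n m"
  shows "\<exists>x\<in>verts E. s \<otimes> V x = s \<and> (\<forall>y\<in>verts E - {x}. s \<otimes> V y = \<zero>)"
proof -
  from s obtain u p v u' q v' where s': "s = path u p \<otimes> ghost u' q"
    and w: "awalk u p v" "awalk u' q v'"
    unfolding monomials_def by blast
  have "s \<otimes> V y = (if y = u' then s else \<zero>)" if "y \<in> verts E" for y
    using that s' w ghost_V[OF w(2) that] path_closed[OF w(1)] ghost_closed[OF w(2)]
    by (simp add: m_assoc)
  then show ?thesis using w by (intro bexI[of _ u']) auto
qed

lemma monomials_Y:
  assumes s: "s \<in> monomials n m" and e: "e \<in> arcs E"
  shows "s \<otimes> Y e \<in> insert \<zero> (monomials (n - 1) (Suc m))"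
proof -
  from s obtain u p v u' q v' where s': "s = path u p \<otimes> ghost u' q"
    and w: "awalk u p v" "awalk u' q v'" and n: "int (length p) - int (length q) = n"
    and m: "length q \<le> m"
    unfolding monomials_def by blast
  note cl = path_closed[OF w(1)] ghost_closed[OF w(2)]
  have se: "s \<otimes> Y e = path u p \<otimes> (ghost u' q \<otimes> Y e)" using s' cl e by (simp add: m_assoc)
  show ?thesis
  proof (cases "head E e = u'")
    case True
    then have "awalk (tail E e) (e # q) v'" using w(2) e by (simp add: awalk_simps)
    from monomialsI[OF w(1) this, of "n - 1" "Suc m"] show ?thesis
      using se True n m by simp
  next
    case False
    then show ?thesis using se ghost_Y_other[OF w(2) e] cl by simp
  qed
qed

text \<open>
  These span what remains of an element \<open>x v\<close> when its part without ghost edges is split off.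
\<close>

definition monomials_from :: "'v \<Rightarrow> 'a set" where
  "monomials_from v = {path u p \<otimes> ghost v (f # q) | u p w f q w'.
     awalk u p w \<and> awalk v (f # q) w'}"

lemma monomials_from_closed: "monomials_from v \<subseteq> carrier M"
  unfolding monomials_from_def by (auto simp del: ghost.simps)

text \<open>
  Among the monomials that survive multiplication by \<open>v\<close>, those with trivial \<open>\<beta>\<close> are paths ending
  at \<open>v\<close>, and all others factor through the ghost of an edge leaving \<open>v\<close>.
\<close>

lemma span_monomials_V_split:
  assumes x: "x \<in> linear_span M (monomials n m)" and v: "v \<in> verts E"
  shows "\<exists>y\<in>linear_span M ((\<lambda>(u, p). path u p) ` paths_into n v).
    \<exists>z\<in>linear_span M (if m = 0 then {} else monomials_from v). x \<otimes> V v = y \<oplus> z"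
  using x
proof induction
  case zero
  then show ?case
    using v by (intro bexI[of _ \<zero>]) (auto intro: linear_span.zero)
next
  case (base s)
  then obtain u p w u' q w' where s': "s = path u p \<otimes> ghost u' q"
    and w: "awalk u p w" "awalk u' q w'" and n: "int (length p) - int (length q) = n"
    and m: "length q \<le> m"
    unfolding monomials_def by blast
  note cl = path_closed[OF w(1)] ghost_closed[OF w(2)]
  have sv: "s \<otimes> V v = (if v = u' then s else \<zero>)"
    using s' w ghost_V[OF w(2) v] cl v by (simp add: m_assoc)
  show ?case
  proof (cases "v = u' \<and> s \<noteq> \<zero>")
    case False
    then have "s \<otimes> V v = \<zero> \<oplus> \<zero>" using sv by auto
    then show ?thesis by (blast intro: linear_span.zero)
  next
    case True
    show ?thesis
    proof (cases q)
      case Nil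
      then have "s = (if u' = w then path u p else \<zero>)"
        using s' path_V[OF w(1), of u'] v True by simp
      then have wv: "w = v" "s = path u p" using True by (auto split: if_splits)
      then have "s \<in> (\<lambda>(u, p). path u p) ` paths_into n v"
        using w(1) n Nil by (force simp: paths_into_def)
      moreover have "s \<otimes> V v = s \<oplus> \<zero>" using sv True cl wv by auto
      ultimately show ?thesis by (blast intro: linear_span.zero linear_span.base)
    next
      case (Cons f r)
      then have "s = path u p \<otimes> ghost v (f # r)" "awalk v (f # r) w'"
        using s' w True by auto
      then have "s \<in> monomials_from v" using w(1) unfolding monomials_from_def by blast
      moreover have "m \<noteq> 0" using Cons m by auto
      moreover have "s \<otimes> V v = \<zero> \<oplus> s" using sv True cl s' by auto
      ultimately show ?thesis
        by (intro bexI[of _ \<zero>] bexI[of _ s]) (auto intro: linear_span.zero linear_span.base)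
    qed
  qed
next
  case (add x x')
  let ?P = "(\<lambda>(u, p). path u p) ` paths_into n v"
  let ?G = "if m = 0 then {} else monomials_from v"
  obtain y z y' z' where yz: "y \<in> linear_span M ?P" "z \<in> linear_span M ?G" "x \<otimes> V v = y \<oplus> z"
    "y' \<in> linear_span M ?P" "z' \<in> linear_span M ?G" "x' \<otimes> V v = y' \<oplus> z'"
    using add.IH by blast
  have P: "?P \<subseteq> carrier M" and G: "?G \<subseteq> carrier M"
    using monomials_from_closed by (auto simp: paths_into_def)
  have "y \<in> carrier M" "y' \<in> carrier M" "z \<in> carrier M" "z' \<in> carrier M"
    using yz linear_span_closed[OF P] linear_span_closed[OF G] by auto
  moreover have "x \<in> carrier M" "x' \<in> carrier M"
    using add.hyps linear_span_closed[OF monomials_closed] by auto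
  ultimately have "(x \<oplus> x') \<otimes> V v = (y \<oplus> y') \<oplus> (z \<oplus> z')"
    using yz v by (simp add: l_distr a_ac)
  then show ?case using yz by (blast intro: linear_span.add)
next
  case (smult x c)
  let ?P = "(\<lambda>(u, p). path u p) ` paths_into n v"
  let ?G = "if m = 0 then {} else monomials_from v"
  obtain y z where yz: "y \<in> linear_span M ?P" "z \<in> linear_span M ?G" "x \<otimes> V v = y \<oplus> z"
    using smult.IH by blast
  have P: "?P \<subseteq> carrier M" and G: "?G \<subseteq> carrier M"
    using monomials_from_closed by (auto simp: paths_into_def)
  have "y \<in> carrier M" "z \<in> carrier M"
    using yz linear_span_closed[OF P] linear_span_closed[OF G] by auto
  moreover have "x \<in> carrier M"
    using smult.hyps linear_span_closed[OF monomials_closed] by auto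
  ultimately have "(c \<odot> x) \<otimes> V v = c \<odot> y \<oplus> c \<odot> z"
    using yz v by (simp add: mult_smult_left smult_r_distr)
  then show ?case using yz by (blast intro: linear_span.smult)
qed

lemma monomials_from_edge:
  assumes "s \<in> monomials_from v"
  shows "\<exists>f\<in>out_arcs E v. s \<otimes> X f \<otimes> Y f = s \<and> (\<forall>e\<in>out_arcs E v - {f}. s \<otimes> X e \<otimes> Y e = \<zero>)"
proof -
  from assms obtain u p w f q w' where s: "s = path u p \<otimes> ghost v (f # q)"
    and w: "awalk u p w" "awalk v (f # q) w'"
    unfolding monomials_from_def by blast
  note cl = path_closed[OF w(1)] ghost_closed[OF w(2)]
  have f: "f \<in> out_arcs E v" and q: "awalk (head E f) q w'" using w by (auto simp: awalk_simps)
  have "s \<otimes> X e \<otimes> Y e = (if f = e then s else \<zero>)" if "e \<in> out_arcs E v" for e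
  proof -
    have e: "e \<in> arcs E" using that by simp
    have "s \<otimes> X e = path u p \<otimes> (ghost v (f # q) \<otimes> X e)"
      using s cl e by (simp add: m_assoc del: ghost.simps)
    also have "\<dots> = (if f = e then path u p \<otimes> ghost (head E f) q else \<zero>)"
      using ghost_Cons_X[OF w(2) e] cl by auto
    finally show ?thesis
      using s cl e ghost_closed[OF q] by (auto simp: m_assoc)
  qed
  then show ?thesis using f by (intro bexI[of _ f]) auto
qed

lemma linear_map_edge_projection: "e \<in> out_arcs E v \<Longrightarrow> linear_map (\<lambda>x. x \<otimes> X e \<otimes> Y e)"
  by (rule linear_map_comp[OF linear_map_rmult linear_map_rmult]) auto

text \<open>
  Right multiplications by \<open>f f\<^sup>*\<close>, for the edges \<open>f\<close> leaving \<open>v\<close>, are orthogonal projections, and each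
  monomial \<open>\<alpha> \<beta>\<^sup>*\<close> with \<open>\<beta>\<close> starting with \<open>f\<close> is fixed by the one for \<open>f\<close>. So an
  element of their span is the sum of its finitely many non-zero images, as if a Cuntz--Krieger
  relation held at \<open>v\<close>.
\<close>

lemma annihilated_by_edges_zero:
  assumes z: "z \<in> linear_span M (monomials_from v)"
    and "\<And>e. e \<in> out_arcs E v \<Longrightarrow> z \<otimes> X e = \<zero>"
  shows "z = \<zero>"
  by (rule linear_span_orthogonal_zero[of "out_arcs E v" "\<lambda>e x. x \<otimes> X e \<otimes> Y e",
        OF linear_map_edge_projection[where v = v] monomials_from_closed monomials_from_edge z])
    (simp_all add: assms(2))

text \<open>
  Only finitely many edges begin a ghost path in a given linear combination. At an infinite
  emitter this leaves an edge that annihilates \<open>z\<close>. The clause for empty \<open>F\<close> covers sinks.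
\<close>

lemma almost_annihilated_by_edges:
  assumes z: "z \<in> linear_span M (monomials_from v)"
  shows "\<exists>F. finite F \<and> F \<subseteq> out_arcs E v \<and> (\<forall>e\<in>out_arcs E v - F. z \<otimes> X e = \<zero>) \<and> (F = {} \<longrightarrow> z = \<zero>)"
proof -
  obtain F where F: "finite F" "F \<subseteq> out_arcs E v"
    "\<forall>e\<in>out_arcs E v - F. z \<otimes> X e \<otimes> Y e = \<zero>" "z = (\<Oplus>e\<in>F. z \<otimes> X e \<otimes> Y e)"
    using linear_span_orthogonal_support[of "out_arcs E v" "\<lambda>e x. x \<otimes> X e \<otimes> Y e",
        OF linear_map_edge_projection[where v = v] monomials_from_closed monomials_from_edge z]
    by auto
  have zc: "z \<in> carrier M" using linear_span_closed[OF monomials_from_closed z] .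
  have "z \<otimes> X e = \<zero>" if "e \<in> out_arcs E v - F" for e
  proof -
    have e: "e \<in> arcs E" using that by simp
    have "z \<otimes> X e = (z \<otimes> X e \<otimes> Y e) \<otimes> X e"
      using e zc by (simp add: m_assoc Y_X X_V)
    also have "z \<otimes> X e \<otimes> Y e = \<zero>" using F(3) that by blast
    finally show ?thesis using e by simp
  qed
  moreover have "z = \<zero>" if "F = {}"
    using F(4) that by simp
  ultimately show ?thesis using F by blast
qed

lemma vanishes_if_annihilates_vertices:
  assumes x: "x \<in> linear_span M (monomials n m)"
    and "\<And>v. v \<in> verts E \<Longrightarrow> x \<otimes> V v = \<zero>"
  shows "x = \<zero>"
  by (rule linear_span_orthogonal_zero[of "verts E" "\<lambda>v x. x \<otimes> V v", OF _ monomials_closed _ x])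
    (use assms(2) monomials_V in \<open>auto intro: linear_map_rmult\<close>)

section \<open>Homogeneous elements of an ideal without vertices\<close>

text \<open>
  Induction on the length of the ghost parts. By the induction hypothesis \<open>x e = 0\<close> for every edge
  \<open>e\<close>, because \<open>x e\<close> lies in \<open>J\<close> and has shorter ghost parts. It remains to see \<open>x v = 0\<close> for
  each vertex \<open>v\<close>. At a regular vertex this is the Cuntz--Krieger relation. Otherwise write
  \<open>x v = y + z\<close> with \<open>y\<close> a combination of paths and \<open>z\<close> of monomials that factor through a ghost edge
  leaving \<open>v\<close>. If \<open>y\<close> were not zero, then \<open>a y = v\<close> for some \<open>a\<close>: at a sink \<open>z = 0\<close>, so that
  \<open>v = a x v\<close> would lie in \<open>J\<close>; at an infinite emitter some edge \<open>e\<close> at \<open>v\<close> has \<open>z e = 0\<close>, hence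
  \<open>e = a y e = a x v e = 0\<close>, and the range of \<open>e\<close> would be zero, again an element of \<open>J\<close>. So
  \<open>x v = z\<close>, and \<open>z\<close> is zero because it is annihilated by all edges at \<open>v\<close>.
\<close>

lemma no_homogeneous_kernel:
  assumes J: "J \<subseteq> carrier M"
    and left: "\<And>a x. \<lbrakk>a \<in> carrier M; x \<in> J\<rbrakk> \<Longrightarrow> a \<otimes> x \<in> J"
    and right: "\<And>a x. \<lbrakk>a \<in> carrier M; x \<in> J\<rbrakk> \<Longrightarrow> x \<otimes> a \<in> J"
    and vertex: "\<And>v. v \<in> verts E \<Longrightarrow> V v \<notin> J"
    and x: "x \<in> linear_span M (monomials n m)" "x \<in> J"
  shows "x = \<zero>"
  using x
proof (induction m arbitrary: n x)
  case 0
  \<comment> \<open>Multiplying by an edge does not lower the bound \<open>0\<close>; but here \<open>x v\<close> is a combination of paths.\<close>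
  show ?case
  proof (rule vanishes_if_annihilates_vertices[OF "0.prems"(1)])
    fix v assume v: "v \<in> verts E"
    obtain y z where y: "y \<in> linear_span M ((\<lambda>(u, p). path u p) ` paths_into n v)"
      and z: "z \<in> linear_span M {}" and split: "x \<otimes> V v = y \<oplus> z"
      using span_monomials_V_split[OF "0.prems"(1) v] by auto
    have yc: "y \<in> carrier M" using linear_span_closed[OF paths_into_closed y] .
    have "z = \<zero>" using linear_span_orthogonal_zero[of "{}", OF _ _ _ z] by simp
    then have xy: "x \<otimes> V v = y" using split yc by simp
    then have "y \<in> J" using right[OF _ "0.prems"(2)] v by auto
    show "x \<otimes> V v = \<zero>"
    proof (rule ccontr)
      assume "x \<otimes> V v \<noteq> \<zero>"
      then obtain a where "a \<in> carrier M" "a \<otimes> y = V v"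
        using nonzero_path_combination_generates_vertex[OF y v] xy by blast
      then show False using left[of a y] \<open>y \<in> J\<close> vertex[OF v] by auto
    qed
  qed
next
  case (Suc m)
  have xc: "x \<in> carrier M" using Suc.prems J by blast
  then have zero: "\<zero> \<in> J" using left[OF zero_closed Suc.prems(2)] by simp
  have xe: "x \<otimes> X e = \<zero>" if e: "e \<in> arcs E" for e
  proof (rule Suc.IH)
    show "x \<otimes> X e \<in> linear_span M (monomials (n + 1) m)"
    proof (rule linear_span_image[OF linear_map_rmult monomials_closed _ Suc.prems(1)])
      fix s assume "s \<in> monomials n (Suc m)"
      then have "s \<otimes> X e = \<zero> \<or> s \<otimes> X e \<in> monomials (n + 1) m"
        using monomials_X[OF _ e] by fastforce
      then show "s \<otimes> X e \<in> linear_span M (monomials (n + 1) m)"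
        by (elim disjE) (simp_all only: linear_span.base linear_span.zero)
    qed (use e in simp)
    show "x \<otimes> X e \<in> J" using right[OF X_closed[OF e] Suc.prems(2)] .
  qed
  show ?case
  proof (rule vanishes_if_annihilates_vertices[OF Suc.prems(1)])
    fix v assume v: "v \<in> verts E"
    have xve: "(x \<otimes> V v) \<otimes> X e = \<zero>" if "e \<in> out_arcs E v" for e
      using that v xc xe V_X by (auto simp: m_assoc)
    show "x \<otimes> V v = \<zero>"
    proof (cases "regular_vertex E v")
      case True
      then have fin: "finite (out_arcs E v)" by (simp add: regular_vertex_def)
      have "x \<otimes> V v = (\<Oplus>e\<in>out_arcs E v. x \<otimes> (X e \<otimes> Y e))"
        unfolding cuntz_krieger[OF True]
        by (rule linear_map_finsum[OF linear_map_lmult[OF xc] fin]) auto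
      also have "\<dots> = \<zero>"
      proof (rule add.finprod_one_eqI)
        fix e assume "e \<in> out_arcs E v"
        then have e: "e \<in> arcs E" by simp
        then have "x \<otimes> (X e \<otimes> Y e) = (x \<otimes> X e) \<otimes> Y e" using xc by (simp add: m_assoc)
        then show "x \<otimes> (X e \<otimes> Y e) = \<zero>" using xe[OF e] e by simp
      qed
      finally show ?thesis .
    next
      case False
      then have sink_or_infinite: "out_arcs E v = {} \<or> infinite (out_arcs E v)"
        using v by (auto simp: regular_vertex_def)
      obtain y z where y: "y \<in> linear_span M ((\<lambda>(u, p). path u p) ` paths_into n v)"
        and z: "z \<in> linear_span M (monomials_from v)" and split: "x \<otimes> V v = y \<oplus> z"
        using span_monomials_V_split[OF Suc.prems(1) v] by auto
      have yc: "y \<in> carrier M" using linear_span_closed[OF paths_into_closed y] .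
      have zc: "z \<in> carrier M" using linear_span_closed[OF monomials_from_closed z] .
      obtain F where F: "finite F" "F \<subseteq> out_arcs E v"
        "\<forall>e\<in>out_arcs E v - F. z \<otimes> X e = \<zero>" "F = {} \<longrightarrow> z = \<zero>"
        using almost_annihilated_by_edges[OF z] by blast
      have y0: "y = \<zero>"
      proof (rule ccontr)
        assume "y \<noteq> \<zero>"
        then obtain a where a: "a \<in> carrier M" "a \<otimes> y = V v"
          using nonzero_path_combination_generates_vertex[OF y v] by blast
        from sink_or_infinite show False
        proof
          assume "out_arcs E v = {}"
          then have "x \<otimes> V v = y" using F split yc by simp
          then have "a \<otimes> y \<in> J" using left[OF a(1)] right[OF V_closed[OF v] Suc.prems(2)] by simp
          then show False using a(2) vertex[OF v] by simp
        next
          assume "infinite (out_arcs E v)"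
          then obtain e where e: "e \<in> out_arcs E v - F"
            using infinite_imp_nonempty[OF Diff_infinite_finite[OF F(1)]] by blast
          then have arc: "e \<in> arcs E" "tail E e = v" by auto
          have "y \<otimes> X e = (x \<otimes> V v) \<otimes> X e"
            using split F(3) e arc yc zc by (simp add: l_distr)
          also have "\<dots> = \<zero>" using xve e by blast
          finally have "a \<otimes> y \<otimes> X e = \<zero>" using a(1) yc arc by (simp add: m_assoc)
          then have "X e = \<zero>" using a(2) V_X[OF arc(1)] arc by simp
          then have "V (head E e) = \<zero>" using Y_X[OF arc(1) arc(1)] arc by simp
          then show False using vertex[of "head E e"] zero arc by simp
        qed
      qed
      then have xz: "x \<otimes> V v = z" using split zc by simp
      then show ?thesis using annihilated_by_edges_zero[OF z] xve by simp
    qed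
  qed
qed

section \<open>The homogeneous components\<close>

definition homogeneous_monomials :: "int \<Rightarrow> 'a set" where
  "homogeneous_monomials n = (\<Union>m. monomials n m)"

lemma homogeneous_monomials_closed: "homogeneous_monomials n \<subseteq> carrier M"
  using monomials_closed by (auto simp: homogeneous_monomials_def)

lemma span_homogeneous_monomials_bounded:
  assumes "x \<in> linear_span M (homogeneous_monomials n)"
  shows "\<exists>m. x \<in> linear_span M (monomials n m)"
  using assms
proof induction
  case (base x)
  then show ?case by (auto simp: homogeneous_monomials_def intro: linear_span.base)
next
  case (add x y)
  then obtain m m' where "x \<in> linear_span M (monomials n m)" "y \<in> linear_span M (monomials n m')"
    by blast
  then have "x \<in> linear_span M (monomials n (max m m'))" "y \<in> linear_span M (monomials n (max m m'))"
    using linear_span_mono[OF monomials_mono] by (meson max.cobounded1 max.cobounded2)+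
  then show ?case by (blast intro: linear_span.add)
qed (blast intro: linear_span.intros)+

text \<open>
  A graded homomorphism turns such a sum into the homogeneous decomposition of the image.
\<close>

lemma homogeneous_decomposition:
  assumes "x \<in> linear_span M (\<Union>n. homogeneous_monomials n)"
  shows "\<exists>N f. finite N \<and> (\<forall>n. f n \<in> linear_span M (homogeneous_monomials n)) \<and>
    (\<forall>n. n \<notin> N \<longrightarrow> f n = \<zero>) \<and> x = (\<Oplus>n\<in>N. f n)"
  using assms
proof induction
  case zero
  then show ?case by (intro exI[of _ "{}"] exI[of _ "\<lambda>_. \<zero>"]) (auto intro: linear_span.zero)
next
  case (base x)
  then obtain n where n: "x \<in> homogeneous_monomials n" by blast
  then have "x \<in> carrier M" using homogeneous_monomials_closed by blast
  then show ?case using n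
    by (intro exI[of _ "{n}"] exI[of _ "\<lambda>i. if i = n then x else \<zero>"])
      (auto intro: linear_span.zero linear_span.base)
next
  case (add x y)
  then obtain N f N' f' where
    f: "finite N" "\<forall>n. f n \<in> linear_span M (homogeneous_monomials n)"
      "\<forall>n. n \<notin> N \<longrightarrow> f n = \<zero>" "x = (\<Oplus>n\<in>N. f n)" and
    f': "finite N'" "\<forall>n. f' n \<in> linear_span M (homogeneous_monomials n)"
      "\<forall>n. n \<notin> N' \<longrightarrow> f' n = \<zero>" "y = (\<Oplus>n\<in>N'. f' n)" by metis
  have c: "f n \<in> carrier M" "f' n \<in> carrier M" for n
    using f(2) f'(2) linear_span_closed[OF homogeneous_monomials_closed] by auto
  have "x = (\<Oplus>n\<in>N \<union> N'. f n)" "y = (\<Oplus>n\<in>N \<union> N'. f' n)"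
    unfolding f(4) f'(4) by (rule finsum_extend; use f f' c in auto)+
  then have "x \<oplus> y = (\<Oplus>n\<in>N \<union> N'. f n \<oplus> f' n)"
    using add.finprod_multf[of f "N \<union> N'" f'] c by simp
  then show ?case using f f' c
    by (intro exI[of _ "N \<union> N'"] exI[of _ "\<lambda>n. f n \<oplus> f' n"]) (auto intro: linear_span.add)
next
  case (smult x c)
  then obtain N f where
    f: "finite N" "\<forall>n. f n \<in> linear_span M (homogeneous_monomials n)"
      "\<forall>n. n \<notin> N \<longrightarrow> f n = \<zero>" "x = (\<Oplus>n\<in>N. f n)" by metis
  have fc: "f n \<in> carrier M" for n
    using f(2) linear_span_closed[OF homogeneous_monomials_closed] by auto
  have "c \<odot> x = (\<Oplus>n\<in>N. c \<odot> f n)"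
    unfolding f(4) by (rule linear_map_finsum[OF linear_map_smult_const f(1)]) (use fc in auto)
  then show ?case using f linear_map_zero[OF linear_map_smult_const]
    by (intro exI[of _ N] exI[of _ "\<lambda>n. c \<odot> f n"]) (auto intro: linear_span.smult)
qed

text \<open>
  Together with the inclusion below, this lets every word in the generators be
  rewritten, letter by letter, as a combination of monomials \<open>\<alpha> \<beta>\<^sup>*\<close>.
\<close>

lemma span_homogeneous_rmult:
  assumes x: "x \<in> linear_span M (\<Union>n. homogeneous_monomials n)"
    and g: "g \<in> V ` verts E \<union> X ` arcs E \<union> Y ` arcs E"
  shows "x \<otimes> g \<in> linear_span M (\<Union>n. homogeneous_monomials n)"
proof (rule linear_span_image[OF linear_map_rmult _ _ x])
  let ?H = "\<Union>n. homogeneous_monomials n"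
  show "g \<in> carrier M" using g by auto
  show "?H \<subseteq> carrier M" using homogeneous_monomials_closed by blast
  fix s assume "s \<in> ?H"
  then obtain n m where s: "s \<in> monomials n m" by (auto simp: homogeneous_monomials_def)
  from g consider v where "v \<in> verts E" "g = V v" | e where "e \<in> arcs E" "g = X e"
    | e where "e \<in> arcs E" "g = Y e" by auto
  then have "s \<otimes> g \<in> insert s (insert \<zero> (\<Union>i j. monomials i j))"
  proof cases
    case 1
    then show ?thesis using monomials_V[OF s] by auto
  next
    case 2
    then show ?thesis using monomials_X[OF s 2(1)] by (auto simp only: )
  next
    case 3
    then show ?thesis using monomials_Y[OF s 3(1)] by (auto simp only: )
  qed
  then have "s \<otimes> g \<in> insert s (insert \<zero> ?H)"
    unfolding homogeneous_monomials_def .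
  then have "s \<otimes> g = \<zero> \<or> s \<otimes> g \<in> ?H"
    using \<open>s \<in> ?H\<close> by (elim insertE) simp_all
  then show "s \<otimes> g \<in> linear_span M ?H" 
    by (elim disjE) (simp_all only: linear_span.base linear_span.zero)
qed

lemma generators_homogeneous:
  "V ` verts E \<union> X ` arcs E \<union> Y ` arcs E \<subseteq> (\<Union>n. homogeneous_monomials n)"
proof -
  have "V v \<in> monomials 0 0" if v: "v \<in> verts E" for v
    using path_in_monomials[of v "[]" v 0] v by (simp add: awalk_simps)
  moreover have "X e \<in> monomials 1 0" if e: "e \<in> arcs E" for e
    using path_in_monomials[of "tail E e" "[e]" "head E e" 0] e
    by (simp add: awalk_simps X_V)
  moreover have "Y e \<in> monomials (-1) 1" if e: "e \<in> arcs E" for e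
    using monomialsI[of "head E e" "[]" "head E e" "tail E e" "[e]" "head E e" "-1" 1] e
    by (simp add: awalk_simps V_Y)
  ultimately show ?thesis unfolding homogeneous_monomials_def by blast
qed

end

section \<open>Quotients of algebras\<close>

locale field_algebra_ideal = field_algebra M + additive_subgroup I M
  for M :: "('k::field, 'a) module" (structure) and I :: "'a set" +
  assumes ideal_smult: "x \<in> I \<Longrightarrow> c \<odot> x \<in> I"
    and ideal_left: "\<lbrakk>a \<in> carrier M; x \<in> I\<rbrakk> \<Longrightarrow> a \<otimes> x \<in> I"
    and ideal_right: "\<lbrakk>a \<in> carrier M; x \<in> I\<rbrakk> \<Longrightarrow> x \<otimes> a \<in> I"
begin

sublocale abelian_subgroup I M
  by (rule abelian_subgroupI3) unfold_locales

lemma coset_eqI: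
  assumes "x \<in> carrier M" "y \<in> I +> x" shows "I +> y = I +> x"
  using a_repr_independence'[OF assms(2,1)] by simp

lemma coset_elem:
  assumes "y \<in> I +> x" shows "\<exists>i\<in>I. y = i \<oplus> x"
  using assms by (auto simp: a_r_coset_def')

lemma coset_add_ideal: "\<lbrakk>i \<in> I; x \<in> carrier M\<rbrakk> \<Longrightarrow> I +> (i \<oplus> x) = I +> x"
  by (rule coset_eqI) (auto simp: a_r_coset_def')

lemma quotient_carrier: "carrier (quotient_algebra M I) = (\<lambda>x. I +> x) ` carrier M"
  by (auto simp: quotient_algebra_def ring.defs module.defs FactRing_def A_RCOSETS_def' )

lemma quotient_zero: "\<zero>\<^bsub>quotient_algebra M I\<^esub> = I"
  by (simp add: quotient_algebra_def ring.defs module.defs FactRing_def)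

lemma quotient_add:
  "\<lbrakk>x \<in> carrier M; y \<in> carrier M\<rbrakk> \<Longrightarrow> (I +> x) \<oplus>\<^bsub>quotient_algebra M I\<^esub> (I +> y) = I +> (x \<oplus> y)"
  by (simp add: quotient_algebra_def ring.defs module.defs FactRing_def a_rcos_sum)

lemma quotient_mult:
  assumes "x \<in> carrier M" "y \<in> carrier M"
  shows "(I +> x) \<otimes>\<^bsub>quotient_algebra M I\<^esub> (I +> y) = I +> (x \<otimes> y)"
proof -
  have "I +> (a \<otimes> b) = I +> (x \<otimes> y)" if ab: "a \<in> I +> x" "b \<in> I +> y" for a b
  proof -
    obtain i j where ij: "i \<in> I" "j \<in> I" "a = i \<oplus> x" "b = j \<oplus> y"
      using coset_elem[OF ab(1)] coset_elem[OF ab(2)] by blast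
    then have c: "i \<in> carrier M" "j \<in> carrier M" using a_subset by auto
    have "a \<otimes> b = (i \<otimes> j \<oplus> i \<otimes> y \<oplus> x \<otimes> j) \<oplus> x \<otimes> y"
      using ij c assms by (simp add: l_distr r_distr a_ac)
    moreover have "i \<otimes> j \<oplus> i \<otimes> y \<oplus> x \<otimes> j \<in> I"
      using ij c assms by (intro a_closed ideal_left ideal_right) auto
    ultimately show ?thesis using assms by (simp add: coset_add_ideal)
  qed
  moreover have "x \<in> I +> x" "y \<in> I +> y" using assms a_rcos_self by auto
  ultimately have "rcoset_mult M I (I +> x) (I +> y) = I +> (x \<otimes> y)"
    unfolding rcoset_mult_def by blast
  then show ?thesis by (simp add: quotient_algebra_def ring.defs module.defs FactRing_def)
qed

lemma quotient_smult:
  assumes "x \<in> carrier M"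
  shows "c \<odot>\<^bsub>quotient_algebra M I\<^esub> (I +> x) = I +> (c \<odot> x)"
proof -
  have "I +> (c \<odot> a) = I +> (c \<odot> x)" if a: "a \<in> I +> x" for a
  proof -
    obtain i where i: "i \<in> I" "a = i \<oplus> x" using coset_elem[OF a] by blast
    then have "i \<in> carrier M" using a_subset by auto
    then show ?thesis using i assms by (simp add: smult_r_distr coset_add_ideal ideal_smult)
  qed
  moreover have "x \<in> I +> x" using assms a_rcos_self by auto
  ultimately have "(\<Union>a\<in>I +> x. I +> (c \<odot> a)) = I +> (c \<odot> x)" by blast
  then show ?thesis by (simp add: quotient_algebra_def ring.defs module.defs)
qed

lemma coset_zero: "I +> \<zero> = I" using a_rcos_const zero_closed by blast

lemma quotient_field_algebra: "field_algebra (quotient_algebra M I)"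
proof -
  let ?Q = "quotient_algebra M I"
  note Q = quotient_carrier quotient_add quotient_mult quotient_smult quotient_zero
  have zero: "\<zero>\<^bsub>?Q\<^esub> = I +> \<zero>" by (simp add: quotient_zero coset_zero)
  interpret Q: abelian_group ?Q
  proof (rule abelian_groupI)
    fix x assume "x \<in> carrier ?Q"
    then obtain a where a: "a \<in> carrier M" "x = I +> a" by (auto simp: Q)
    then have "(I +> \<ominus> a) \<oplus>\<^bsub>?Q\<^esub> x = \<zero>\<^bsub>?Q\<^esub>" by (simp add: quotient_add zero l_neg)
    then show "\<exists>y\<in>carrier ?Q. y \<oplus>\<^bsub>?Q\<^esub> x = \<zero>\<^bsub>?Q\<^esub>" using a by (force simp: quotient_carrier)
  qed (auto simp: quotient_carrier quotient_add zero a_ac)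
  show ?thesis
    by unfold_locales
      (auto simp: quotient_carrier quotient_add quotient_mult quotient_smult m_assoc l_distr r_distr
        smult_r_distr smult_l_distr smult_assoc smult_one mult_smult_left mult_smult_right)
qed

end

lemma (in field_algebra) algebra_ideal_closed:
  assumes "S \<subseteq> carrier M" and "x \<in> algebra_ideal M S"
  shows "x \<in> carrier M"
  using assms(2) by induction (use assms(1) in auto)

lemma (in field_algebra) minus_conv_smult: "x \<in> carrier M \<Longrightarrow> \<ominus> x = (- 1) \<odot> x"
  using smult_l_distr[of x "- 1" 1] by (intro minus_equality) (auto simp: smult_one)

lemma (in field_algebra) algebra_ideal_is_ideal:
  assumes S: "S \<subseteq> carrier M"
  shows "field_algebra_ideal M (algebra_ideal M S)"
proof -
  have sub: "algebra_ideal M S \<subseteq> carrier M" using algebra_ideal_closed[OF S] by blast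
  have "subgroup (algebra_ideal M S) (add_monoid M)"
  proof (rule add.subgroupI)
    fix x assume "x \<in> algebra_ideal M S"
    moreover from this have "\<ominus> x = (- 1) \<odot> x" using sub minus_conv_smult by blast
    ultimately show "\<ominus> x \<in> algebra_ideal M S" using algebra_ideal.smult by metis
  next
    show "algebra_ideal M S \<noteq> {}" using algebra_ideal.zero by blast
  qed (use sub algebra_ideal.add in auto)
  then interpret additive_subgroup "algebra_ideal M S" M by (rule additive_subgroup.intro)
  show ?thesis
    by unfold_locales (auto intro: algebra_ideal.intros)
qed

section \<open>The free algebra\<close>

text \<open>
  Scalar multiplication in the free algebra is multiplication by a constant. Constants are central
  although the words do not commute, because the empty word is neutral.
\<close>

lemma single_zero_commutes:
  fixes p :: "('g, 'k::field) free_alg"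
  shows "Poly_Mapping.single 0 c * p = p * Poly_Mapping.single 0 c"
proof (induction p rule: update_induct)
  case const
  then show ?case by simp
next
  case (update p k a)
  then have "Poly_Mapping.update k a p = p + Poly_Mapping.single k a"
    by (intro poly_mapping_eqI) (auto simp: lookup_update lookup_add lookup_single in_keys_iff)
  then show ?case using update
    by (simp add: distrib_left distrib_right mult_single mult.commute)
qed

lemma free_algebra_sel:
  "carrier (free_algebra G) = {p. \<forall>w\<in>Poly_Mapping.keys p. letters w \<noteq> [] \<and> set (letters w) \<subseteq> G}"
  "x \<otimes>\<^bsub>free_algebra G\<^esub> y = x * y" "x \<oplus>\<^bsub>free_algebra G\<^esub> y = x + y" "\<zero>\<^bsub>free_algebra G\<^esub> = 0"
  "c \<odot>\<^bsub>free_algebra G\<^esub> x = Poly_Mapping.single 0 c * x"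
  by (simp_all add: free_algebra_def mult_map_scale_conv_mult)

lemma letters_plus: "letters (u + w) = letters u @ letters w"
  by (simp add: plus_free_word_def)

lemma free_algebra_closed:
  assumes "p \<in> carrier (free_algebra G)" "q \<in> carrier (free_algebra G)"
  shows "p + q \<in> carrier (free_algebra G)" "p * q \<in> carrier (free_algebra G)"
    "- p \<in> carrier (free_algebra G)" "Poly_Mapping.single 0 c * p \<in> carrier (free_algebra G)"
proof -
  show "p + q \<in> carrier (free_algebra G)"
    using assms keys_add[of p q] by (auto simp: free_algebra_sel)
  show "p * q \<in> carrier (free_algebra G)"
    using assms keys_mult[of p q] by (fastforce simp: free_algebra_sel letters_plus)
  show "- p \<in> carrier (free_algebra G)"
    using assms by (simp add: free_algebra_sel)
  have "Poly_Mapping.keys (Poly_Mapping.single 0 c * p) \<subseteq> Poly_Mapping.keys p"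
    using keys_mult[of "Poly_Mapping.single 0 c" p] by (auto split: if_splits)
  then show "Poly_Mapping.single 0 c * p \<in> carrier (free_algebra G)"
    using assms by (auto simp: free_algebra_sel(1))
qed

lemma free_algebra_is_field_algebra:
  "field_algebra (free_algebra G :: ('k::field, ('g, 'k) free_alg) module)"
proof -
  interpret abelian_group "free_algebra G :: ('k, ('g, 'k) free_alg) module"
  proof (rule abelian_groupI)
    fix x :: "('g, 'k) free_alg" assume "x \<in> carrier (free_algebra G)"
    then show "\<exists>y\<in>carrier (free_algebra G). y \<oplus>\<^bsub>free_algebra G\<^esub> x = \<zero>\<^bsub>free_algebra G\<^esub>"
      using free_algebra_closed(3) by (intro bexI[of _ "- x"]) (auto simp: free_algebra_sel(3,4))
  qed (auto simp: free_algebra_sel(2-5) free_algebra_closed add_ac, simp add: free_algebra_sel)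
  show ?thesis
  proof
    fix x y :: "('g, 'k) free_alg" and c :: 'k
    show "x \<otimes>\<^bsub>free_algebra G\<^esub> (c \<odot>\<^bsub>free_algebra G\<^esub> y) = c \<odot>\<^bsub>free_algebra G\<^esub> (x \<otimes>\<^bsub>free_algebra G\<^esub> y)"
      unfolding free_algebra_sel(2,5)
      using mult.assoc[of x "Poly_Mapping.single 0 c" y] mult.assoc[of "Poly_Mapping.single 0 c" x y]
        single_zero_commutes[of c x] by argo
  qed (auto simp: free_algebra_sel(2-5) free_algebra_closed algebra_simps single_add mult_single
      simp flip: mult.assoc)
qed

lemma word_monom_closed:
  "w \<noteq> [] \<Longrightarrow> set w \<subseteq> G \<Longrightarrow> word_monom w \<in> carrier (free_algebra G)"
  by (auto simp: word_monom_def free_algebra_sel)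

lemma word_monom_append: "word_monom (u @ w) = word_monom u * word_monom w"
  by (simp add: word_monom_def mult_single plus_free_word_def)

lemma free_algebra_spanned_by_words:
  assumes "p \<in> carrier (free_algebra G :: ('k::field, ('g, 'k) free_alg) module)"
  shows "p \<in> linear_span (free_algebra G) (word_monom ` {w. w \<noteq> [] \<and> set w \<subseteq> G})"
  using assms
proof (induction p rule: update_induct)
  case const
  then show ?case using linear_span.zero[of "free_algebra G"] by (simp add: free_algebra_sel(4))
next
  case (update p k a)
  let ?L = "linear_span (free_algebra G) (word_monom ` {w. w \<noteq> [] \<and> set w \<subseteq> G})"
  have upd: "Poly_Mapping.update k a p = p + Poly_Mapping.single k a"
    using update.hyps
    by (intro poly_mapping_eqI) (auto simp: lookup_update lookup_add lookup_single in_keys_iff)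
  have keys: "Poly_Mapping.keys (Poly_Mapping.update k a p) = insert k (Poly_Mapping.keys p)"
    using update.hyps by (simp add: keys_update)
  have "p \<in> ?L" using update keys by (simp add: free_algebra_sel(1))
  moreover have "word_monom (letters k) \<in> ?L"
    using update.prems keys by (intro linear_span.base) (auto simp: free_algebra_sel(1))
  then have "Poly_Mapping.single 0 a * word_monom (letters k) \<in> ?L"
    using linear_span.smult[of "word_monom (letters k)" "free_algebra G" _ a]
    by (simp add: free_algebra_sel(5))
  then have "Poly_Mapping.single k a \<in> ?L" by (simp add: word_monom_def mult_single)
  ultimately show ?case
    using linear_span.add[of p "free_algebra G"] by (simp add: upd free_algebra_sel(3))
qed

section \<open>The Leavitt path algebra as a Leavitt family\<close>

text \<open>
  The type of the parameter \<open>K\<close> fixes the coefficient field, which \<open>E\<close> does not determine.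
\<close>

locale leavitt_over = wf_digraph E
  for E :: "('v, 'e) pre_digraph" and K :: "'k::field itself"
begin

abbreviation (input) F :: "('k, (('v, 'e) generator, 'k) free_alg) module" where
  "F \<equiv> free_algebra (leavitt_generators E)"

abbreviation (input) L :: "('k, ('v, 'e, 'k) leavitt) module" where
  "L \<equiv> leavitt_algebra E"

sublocale F: field_algebra F by (rule free_algebra_is_field_algebra)

lemma generator_mem:
  "v \<in> verts E \<Longrightarrow> Vertex v \<in> leavitt_generators E"
  "e \<in> arcs E \<Longrightarrow> Edge e \<in> leavitt_generators E"
  "e \<in> arcs E \<Longrightarrow> Ghost e \<in> leavitt_generators E"
  by (auto simp: leavitt_generators_def)

lemma sum_closed: "(\<And>i. i \<in> S \<Longrightarrow> f i \<in> carrier F) \<Longrightarrow> (\<Sum>i\<in>S. f i) \<in> carrier F"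
  by (induction S rule: infinite_finite_induct)
    (auto simp: free_algebra_closed, auto simp: free_algebra_sel)

lemma leavitt_relators_closed: "leavitt_relators E \<subseteq> carrier F"
proof
  fix r :: "(('v, 'e) generator, 'k) free_alg"
  have diff: "p - q \<in> carrier F" if "p \<in> carrier F" "q \<in> carrier F"
    for p q
    using free_algebra_closed(1)[OF that(1) free_algebra_closed(3)[OF that(2) that(2)]] by simp
  assume "r \<in> leavitt_relators E"
  then show "r \<in> carrier F"
    by cases (auto intro!: diff sum_closed word_monom_closed generator_mem
        simp: regular_vertex_def)
qed

sublocale I: field_algebra_ideal F "leavitt_ideal E"
  unfolding leavitt_ideal_def by (rule F.algebra_ideal_is_ideal[OF leavitt_relators_closed])

abbreviation (input) Q :: "(('v, 'e) generator, 'k) free_alg \<Rightarrow> ('v, 'e, 'k) leavitt" where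
  "Q x \<equiv> leavitt_ideal E +>\<^bsub>F\<^esub> x"

lemmas leavitt_ops =
  I.quotient_carrier[folded leavitt_algebra_def] I.quotient_zero[folded leavitt_algebra_def]
  I.quotient_add[folded leavitt_algebra_def] I.quotient_mult[folded leavitt_algebra_def]
  I.quotient_smult[folded leavitt_algebra_def]

lemma leavitt_field_algebra: "field_algebra L"
  unfolding leavitt_algebra_def by (rule I.quotient_field_algebra)

lemma relation_eq:
  assumes "p - q \<in> leavitt_relators E" "q \<in> carrier F"
  shows "Q p = Q q"
proof -
  have "p - q \<in> leavitt_ideal E"
    unfolding leavitt_ideal_def using assms(1) by (rule algebra_ideal.base)
  from I.coset_add_ideal[OF this assms(2)] show ?thesis by (simp add: free_algebra_sel)
qed

lemma coset_zero: "Q 0 = \<zero>\<^bsub>L\<^esub>"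
  using I.coset_zero by (simp only: free_algebra_sel(4) leavitt_ops(2))

lemma relation_zero:
  assumes "p \<in> leavitt_relators E"
  shows "Q p = \<zero>\<^bsub>L\<^esub>"
  using relation_eq[of p 0] assms F.zero_closed coset_zero
  by (simp add: free_algebra_sel(4))

abbreviation (input) valid_word :: "('v, 'e) generator list \<Rightarrow> bool" where
  "valid_word w \<equiv> w \<noteq> [] \<and> set w \<subseteq> leavitt_generators E"

lemma leavitt_monom_closed: "valid_word w \<Longrightarrow> leavitt_monom E w \<in> carrier L"
  using word_monom_closed by (auto simp: leavitt_monom_def leavitt_ops(1))

lemma leavitt_monom_append:
  assumes "valid_word u" "valid_word w"
  shows "leavitt_monom E (u @ w) = leavitt_monom E u \<otimes>\<^bsub>L\<^esub> leavitt_monom E w"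
  using assms
  by (simp add: leavitt_monom_def leavitt_ops(4) free_algebra_sel(2) word_monom_append word_monom_closed)

lemma coset_sum:
  assumes "finite S" "\<And>i. i \<in> S \<Longrightarrow> f i \<in> carrier F"
  shows "Q (\<Sum>i\<in>S. f i) = finsum L (\<lambda>i. Q (f i)) S"
proof -
  interpret L: field_algebra L by (rule leavitt_field_algebra)
  show ?thesis
    using assms
  proof (induction S rule: finite_induct)
    case empty
    then show ?case using coset_zero by simp
  next
    case (insert i S)
    have Qf: "Q (f j) \<in> carrier L" if "j \<in> insert i S" for j
      using insert.prems[OF that] by (simp add: leavitt_ops(1))
    have "Q (f i + sum f S) = Q (f i) \<oplus>\<^bsub>L\<^esub> Q (sum f S)"
      using leavitt_ops(3)[of "f i" "sum f S"] insert.prems sum_closed[of S f]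
      by (simp add: free_algebra_sel(3))
    then show ?case using insert Qf by (simp add: Pi_iff)
  qed
qed

lemma leavitt_algebra_family:
  "leavitt_family L E
     (\<lambda>v. leavitt_monom E [Vertex v]) (\<lambda>e. leavitt_monom E [Edge e]) (\<lambda>e. leavitt_monom E [Ghost e])"
proof -
  let ?L = L
  let ?m = "leavitt_monom E :: _ \<Rightarrow> ('v, 'e, 'k) leavitt"
  have two: "?m [a] \<otimes>\<^bsub>?L\<^esub> ?m [b] = ?m [a, b]"
    if "a \<in> leavitt_generators E" "b \<in> leavitt_generators E" for a b
    using leavitt_monom_append[of "[a]" "[b]"] that by simp
  have rel: "?m u = ?m w" if "(word_monom u - word_monom w :: (_, 'k) free_alg) \<in> leavitt_relators E" "valid_word w" for u w
    using relation_eq[OF that(1)] that(2) by (simp add: leavitt_monom_def word_monom_closed)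
  have rel0: "?m u = \<zero>\<^bsub>?L\<^esub>" if "(word_monom u :: (_, 'k) free_alg) \<in> leavitt_relators E" for u
    using relation_zero[OF that] by (simp add: leavitt_monom_def)
  interpret L: field_algebra L by (rule leavitt_field_algebra)
  show ?thesis
  proof
    show "?m [Vertex v] \<in> carrier ?L" if "v \<in> verts E" for v
      using that by (intro leavitt_monom_closed) (simp add: generator_mem)
    show "?m [Edge e] \<in> carrier ?L" "?m [Ghost e] \<in> carrier ?L" if "e \<in> arcs E" for e
      using that by (auto intro!: leavitt_monom_closed simp: generator_mem)
    show "?m [Vertex v] \<otimes>\<^bsub>?L\<^esub> ?m [Vertex w] = (if v = w then ?m [Vertex v] else \<zero>\<^bsub>?L\<^esub>)"
      if "v \<in> verts E" "w \<in> verts E" for v w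
      using that
      by (auto simp: two generator_mem intro!: rel rel0 leavitt_relators.intros)
    show "?m [Vertex (tail E e)] \<otimes>\<^bsub>?L\<^esub> ?m [Edge e] = ?m [Edge e]"
      "?m [Edge e] \<otimes>\<^bsub>?L\<^esub> ?m [Vertex (head E e)] = ?m [Edge e]"
      "?m [Vertex (head E e)] \<otimes>\<^bsub>?L\<^esub> ?m [Ghost e] = ?m [Ghost e]"
      "?m [Ghost e] \<otimes>\<^bsub>?L\<^esub> ?m [Vertex (tail E e)] = ?m [Ghost e]" if "e \<in> arcs E" for e
      using that by (auto simp: two generator_mem intro!: rel leavitt_relators.intros)
    show "?m [Ghost e] \<otimes>\<^bsub>?L\<^esub> ?m [Edge f] = (if e = f then ?m [Vertex (head E e)] else \<zero>\<^bsub>?L\<^esub>)"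
      if "e \<in> arcs E" "f \<in> arcs E" for e f
      using that by (auto simp: two generator_mem intro!: rel rel0 leavitt_relators.intros)
    show "?m [Vertex v] = finsum ?L (\<lambda>e. ?m [Edge e] \<otimes>\<^bsub>?L\<^esub> ?m [Ghost e]) (out_arcs E v)"
      if v: "regular_vertex E v" for v
    proof -
      have fin: "finite (out_arcs E v)" using v by (simp add: regular_vertex_def)
      have c: "word_monom [Edge e, Ghost e] \<in> carrier (free_algebra (leavitt_generators E))"
        if "e \<in> out_arcs E v" for e
        using that by (intro word_monom_closed) (auto simp: generator_mem)
      have "?m [Vertex v] = Q (\<Sum>e\<in>out_arcs E v. word_monom [Edge e, Ghost e])"
        unfolding leavitt_monom_def
        by (rule relation_eq[OF leavitt_relators.cuntz_krieger[OF v] sum_closed[OF c]])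
      also have "\<dots> = finsum ?L (\<lambda>e. ?m [Edge e, Ghost e]) (out_arcs E v)"
        unfolding leavitt_monom_def by (rule coset_sum[OF fin c])
      also have "\<dots> = finsum ?L (\<lambda>e. ?m [Edge e] \<otimes>\<^bsub>?L\<^esub> ?m [Ghost e]) (out_arcs E v)"
      proof (rule L.finsum_cong')
        show "(\<lambda>e. ?m [Edge e] \<otimes>\<^bsub>?L\<^esub> ?m [Ghost e]) \<in> out_arcs E v \<rightarrow> carrier ?L"
          by (auto intro!: L.m_closed leavitt_monom_closed simp: generator_mem)
      qed (auto simp: two generator_mem)
      finally show ?thesis .
    qed
  qed
qed

sublocale L: leavitt_family L E
  "\<lambda>v. leavitt_monom E [Vertex v]" "\<lambda>e. leavitt_monom E [Edge e]" "\<lambda>e. leavitt_monom E [Ghost e]"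
  by (rule leavitt_algebra_family)

lemma leavitt_path_eq:
  assumes "awalk u p v"
  shows "leavitt_path E u p = L.path u p"
  using assms
proof (induction p arbitrary: u)
  case Nil
  then show ?case by (simp add: leavitt_path_def)
next
  case (Cons e p)
  then have w: "e \<in> arcs E" "awalk (head E e) p v" by (auto simp: awalk_simps)
  show ?case
  proof (cases p)
    case Nil
    then show ?thesis using w by (simp add: leavitt_path_def L.X_V)
  next
    case (Cons f r)
    have "valid_word (map Edge p)"
      using w(2) Cons by (auto simp: awalk_def generator_mem)
    then have "leavitt_monom E (map Edge (e # p)) =
        leavitt_monom E [Edge e] \<otimes>\<^bsub>L\<^esub> leavitt_monom E (map Edge p)"
      using leavitt_monom_append[of "[Edge e]" "map Edge p"] w(1) by (simp add: generator_mem)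
    then show ?thesis using Cons.IH[OF w(2)] Cons by (simp add: leavitt_path_def)
  qed
qed

lemma leavitt_ghost_path_eq:
  assumes "awalk u p v"
  shows "leavitt_ghost_path E u p = L.ghost u p"
  using assms
proof (induction p arbitrary: u)
  case Nil
  then show ?case by (simp add: leavitt_ghost_path_def)
next
  case (Cons e p)
  then have w: "e \<in> arcs E" "awalk (head E e) p v" by (auto simp: awalk_simps)
  show ?case
  proof (cases p)
    case Nil
    then show ?thesis using w by (simp add: leavitt_ghost_path_def L.V_Y)
  next
    case (Cons f r)
    have "valid_word (map Ghost (rev p))"
      using w(2) Cons by (auto simp: awalk_def generator_mem)
    then have "leavitt_monom E (map Ghost (rev (e # p))) =
        leavitt_monom E (map Ghost (rev p)) \<otimes>\<^bsub>L\<^esub> leavitt_monom E [Ghost e]"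
      using leavitt_monom_append[of "map Ghost (rev p)" "[Ghost e]"] w(1)
      by (simp add: generator_mem)
    then show ?thesis using Cons.IH[OF w(2)] Cons by (simp add: leavitt_ghost_path_def)
  qed
qed

text \<open>
  The path and ghost path elements of a Leavitt family are defined by recursion on the edges, with
  a final vertex factor; since \<open>e r(e) = e\<close>, they agree with the monomials that define the grading.
\<close>

lemma leavitt_grading_eq:
  "leavitt_grading E n = linear_span L (L.homogeneous_monomials n)"
proof -
  have "{leavitt_path E u p \<otimes>\<^bsub>L\<^esub> leavitt_ghost_path E u' q | u p v u' q v'.
        awalk u p v \<and> awalk u' q v' \<and> int (length p) - int (length q) = n}
     = L.homogeneous_monomials n" (is "?A = ?B")
  proof
    show "?A \<subseteq> ?B"
    proof
      fix x assume "x \<in> ?A"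
      then obtain u p v u' q v' where x: "x = leavitt_path E u p \<otimes>\<^bsub>L\<^esub> leavitt_ghost_path E u' q"
        and w: "awalk u p v" "awalk u' q v'" and n: "int (length p) - int (length q) = n"
        by blast
      then have "x \<in> L.monomials n (length q)"
        using L.monomialsI[OF w n order.refl] by (simp add: leavitt_path_eq leavitt_ghost_path_eq)
      then show "x \<in> ?B" unfolding L.homogeneous_monomials_def by blast
    qed
    show "?B \<subseteq> ?A"
    proof
      fix x assume "x \<in> ?B"
      then obtain u p v u' q v' where x: "x = L.path u p \<otimes>\<^bsub>L\<^esub> L.ghost u' q"
        and w: "awalk u p v" "awalk u' q v'" and n: "int (length p) - int (length q) = n"
        unfolding L.homogeneous_monomials_def L.monomials_def by blast
      have "x = leavitt_path E u p \<otimes>\<^bsub>L\<^esub> leavitt_ghost_path E u' q"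
        using x leavitt_path_eq[OF w(1)] leavitt_ghost_path_eq[OF w(2)] by simp
      then show "x \<in> ?A" using w n by blast
    qed
  qed
  then show ?thesis unfolding leavitt_grading_def by simp
qed

lemma leavitt_monom_in_span:
  assumes "valid_word w"
  shows "leavitt_monom E w \<in> linear_span L (\<Union>n. L.homogeneous_monomials n)"
  using assms
proof (induction w rule: rev_induct)
  case (snoc g w)
  let ?G = "(\<lambda>v. leavitt_monom E [Vertex v]) ` verts E \<union> (\<lambda>e. leavitt_monom E [Edge e]) ` arcs E \<union>
    (\<lambda>e. leavitt_monom E [Ghost e]) ` arcs E"
  have g: "leavitt_monom E [g] \<in> ?G"
    using snoc.prems by (auto simp: leavitt_generators_def)
  show ?case
  proof (cases "w = []")
    case True
    then show ?thesis using g L.generators_homogeneous by (auto intro!: linear_span.base)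
  next
    case False
    then have "leavitt_monom E (w @ [g]) = leavitt_monom E w \<otimes>\<^bsub>L\<^esub> leavitt_monom E [g]"
      using snoc.prems by (intro leavitt_monom_append) auto
    then show ?thesis using L.span_homogeneous_rmult[OF _ g] snoc False by simp
  qed
qed simp

lemma leavitt_algebra_spanned:
  assumes "x \<in> carrier L"
  shows "x \<in> linear_span L (\<Union>n. L.homogeneous_monomials n)"
proof -
  let ?L = "linear_span L (\<Union>n. L.homogeneous_monomials n)"
  obtain p where p: "p \<in> carrier F" "x = Q p"
    using assms by (auto simp: leavitt_ops(1))
  have "Q p \<in> ?L" if "p \<in> linear_span F (word_monom ` {w. valid_word w})"
    for p :: "(('v, 'e) generator, 'k) free_alg"
    using that
  proof induction
    case zero
    then show ?case
      using linear_span.zero[of L] coset_zero by (simp add: free_algebra_sel(4))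
  next
    case (base p)
    then show ?case using leavitt_monom_in_span by (auto simp: leavitt_monom_def)
  next
    case (add p q)
    have "p \<in> carrier F" "q \<in> carrier F"
      using add.hyps F.linear_span_closed[of "word_monom ` {w. valid_word w}"] word_monom_closed
      by blast+
    then show ?case using add.IH by (simp add: leavitt_ops(3)[symmetric] linear_span.add)
  next
    case (smult p c)
    have "p \<in> carrier F"
      using smult.hyps F.linear_span_closed[of "word_monom ` {w. valid_word w}"] word_monom_closed
      by blast
    then show ?case using smult.IH by (simp add: leavitt_ops(5)[symmetric] linear_span.smult)
  qed
  then show ?thesis using free_algebra_spanned_by_words[OF p(1)] p(2) by simp
qed

end

section \<open>Graded uniqueness\<close>

lemma (in int_graded_ring) component_closed: "x \<in> D n \<Longrightarrow> x \<in> carrier R"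
  using additive_subgroup.a_subset[OF component_subgroup] by blast

text \<open>
  Padded with zeros, \<open>g\<close> is a homogeneous decomposition of zero; so is the zero
  family, and decompositions are unique.
\<close>

lemma (in int_graded_ring) homogeneous_sum_zero:
  assumes N: "finite N" and g: "\<And>n. n \<in> N \<Longrightarrow> g n \<in> D n" and sum: "(\<Oplus>n\<in>N. g n) = \<zero>" and n: "n \<in> N"
  shows "g n = \<zero>"
proof -
  let ?P = "\<lambda>f. (\<forall>n. f n \<in> D n) \<and> finite {n. f n \<noteq> \<zero>} \<and> \<zero> = (\<Oplus>n\<in>{n. f n \<noteq> \<zero>}. f n)"
  let ?h = "\<lambda>n. if n \<in> N then g n else \<zero>"
  have zero: "\<zero> \<in> D n" for n
    using additive_subgroup.zero_closed[OF component_subgroup] .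
  have sub: "{n. ?h n \<noteq> \<zero>} \<subseteq> N" by auto
  have "(\<Oplus>n\<in>{n. ?h n \<noteq> \<zero>}. ?h n) = (\<Oplus>n\<in>N. g n)"
    by (rule add.finprod_mono_neutral_cong_left[OF N sub]) (use g component_closed in auto)
  then have h: "?P ?h" using g zero sum finite_subset[OF sub N] by auto
  have "?P (\<lambda>_. \<zero>)" using zero by simp
  note unique = the1_equality[of ?P, OF direct_sum[OF zero_closed]]
  have "?h = (\<lambda>_. \<zero>)"
    by (rule trans[OF unique[OF h, symmetric] unique[OF \<open>?P (\<lambda>_. \<zero>)\<close>]])
  from fun_cong[OF this, of n] show ?thesis using n by simp
qed

text \<open>
  The kernel \<open>J\<close> contains no vertex. If \<open>x\<close> lies in \<open>J\<close>, then so does each of its homogeneous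
  components, because their images lie in different components of \<open>A\<close> and add up to zero.
\<close>

lemma (in leavitt_over) graded_uniqueness:
  fixes A :: "('a, 'b) ring_scheme" (structure) and D :: "int \<Rightarrow> 'a set"
    and \<pi> :: "('v, 'e, 'k) leavitt \<Rightarrow> 'a"
  assumes A: "int_graded_ring A D"
    and \<pi>: "\<pi> \<in> graded_ring_hom L (leavitt_grading E) A D"
    and vertex: "\<And>v. v \<in> verts E \<Longrightarrow> \<pi> (leavitt_vertex E v) \<noteq> \<zero>"
  shows "inj_on \<pi> (carrier L)"
proof -
  interpret A: int_graded_ring A D by (rule A)
  have closed: "\<pi> x \<in> carrier A" if "x \<in> carrier L" for x
    using \<pi> that by (auto simp: graded_ring_hom_def nonunital_ring_hom_def)
  have add: "\<pi> (x \<oplus>\<^bsub>L\<^esub> y) = \<pi> x \<oplus> \<pi> y" and mult: "\<pi> (x \<otimes>\<^bsub>L\<^esub> y) = \<pi> x \<otimes> \<pi> y"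
    if "x \<in> carrier L" "y \<in> carrier L" for x y
    using \<pi> that by (auto simp: graded_ring_hom_def nonunital_ring_hom_def)
  have graded: "\<pi> x \<in> D n" if "x \<in> leavitt_grading E n" for x n
    using \<pi> that by (auto simp: graded_ring_hom_def)
  have zero: "\<pi> \<zero>\<^bsub>L\<^esub> = \<zero>"
    using add[of "\<zero>\<^bsub>L\<^esub>" "\<zero>\<^bsub>L\<^esub>"] closed[of "\<zero>\<^bsub>L\<^esub>"] A.add.l_cancel_one by fastforce
  define J where "J = {x \<in> carrier L. \<pi> x = \<zero>}"
  have hom_zero: "x = \<zero>\<^bsub>L\<^esub>" if x: "x \<in> leavitt_grading E n" "x \<in> J" for x n
  proof -
    obtain m where m: "x \<in> linear_span L (L.monomials n m)"
      using L.span_homogeneous_monomials_bounded x(1) by (auto simp: leavitt_grading_eq)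
    show ?thesis
      by (rule L.no_homogeneous_kernel[OF _ _ _ _ m x(2)])
        (use vertex in \<open>auto simp: J_def mult closed leavitt_vertex_def\<close>)
  qed
  have kernel: "x = \<zero>\<^bsub>L\<^esub>" if x: "x \<in> J" for x
  proof -
    have xc: "x \<in> carrier L" using x by (simp add: J_def)
    obtain N f where N: "finite N" and f: "\<And>n. f n \<in> leavitt_grading E n"
      and xsum: "x = finsum L f N"
      using L.homogeneous_decomposition[OF leavitt_algebra_spanned[OF xc]]
      by (auto simp: leavitt_grading_eq)
    have fc: "f n \<in> carrier L" for n
      by (rule L.linear_span_closed[OF L.homogeneous_monomials_closed f[unfolded leavitt_grading_eq]])
    have "\<pi> (finsum L f S) = (\<Oplus>n\<in>S. \<pi> (f n))" if "finite S" for S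
      using that
    proof (induction S rule: finite_induct)
      case (insert n S)
      then show ?case using fc closed by (simp add: add L.finsum_closed Pi_iff)
    qed (simp add: zero)
    then have "(\<Oplus>n\<in>N. \<pi> (f n)) = \<zero>" using x xsum N by (simp add: J_def)
    then have "\<pi> (f n) = \<zero>" if "n \<in> N" for n
      using A.homogeneous_sum_zero[OF N _ _ that, of "\<lambda>n. \<pi> (f n)"] graded[OF f] by simp
    then have "f n = \<zero>\<^bsub>L\<^esub>" if "n \<in> N" for n
      using hom_zero[OF f] fc that by (simp add: J_def)
    then show ?thesis unfolding xsum by (intro L.add.finprod_one_eqI) auto
  qed
  show ?thesis
  proof (rule inj_onI)
    fix x y assume xy: "x \<in> carrier L" "y \<in> carrier L" "\<pi> x = \<pi> y"
    let ?z = "\<ominus>\<^bsub>L\<^esub> y"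
    have "\<pi> (x \<oplus>\<^bsub>L\<^esub> ?z) = \<pi> y \<oplus> \<pi> ?z" using xy by (simp add: add)
    also have "\<dots> = \<pi> (y \<oplus>\<^bsub>L\<^esub> ?z)" using xy by (simp add: add)
    also have "\<dots> = \<zero>" using xy zero by (simp add: L.r_neg)
    finally have "x \<oplus>\<^bsub>L\<^esub> ?z \<in> J" using xy by (simp add: J_def)
    then have "x \<oplus>\<^bsub>L\<^esub> ?z = \<zero>\<^bsub>L\<^esub>" by (rule kernel)
    then show "x = y" using xy by (metis L.minus_equality L.minus_minus L.a_inv_closed)
  qed
qed

theorem theorem4p8:
  fixes E :: "('v, 'e) pre_digraph"
    and A :: "('a, 'b) ring_scheme"
    and D :: "int \<Rightarrow> 'a set"
    and \<pi> :: "('v, 'e, 'k::field) leavitt \<Rightarrow> 'a"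
  assumes "wf_digraph E" and "countable (verts E)" and "countable (arcs E)"
    and "int_graded_ring A D"
    and "\<pi> \<in> graded_ring_hom (leavitt_algebra E) (leavitt_grading E) A D"
    and "\<And>v. v \<in> verts E \<Longrightarrow> \<pi> (leavitt_vertex E v) \<noteq> \<zero>\<^bsub>A\<^esub>"
  shows "inj_on \<pi> (carrier (leavitt_algebra E))"
proof -
  interpret leavitt_over E "TYPE('k)"
    using assms(1) by (rule leavitt_over.intro)
  show ?thesis by (rule graded_uniqueness[OF assms(4-6)])
qed

end
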